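(* Let $\phi$ be a Ma-Minda function, let $K$ be defined by $1+\frac{zK''(z)}{K'(z)}=\phi(z)$, $K(0)=K'(0)-1=0$, and let $\alpha\in\mathbb{C}$ with $|\alpha|\le1$. Let $f=h+\overline{g}\in\mathcal{HC}(\phi)$ with $h(z)=z+\sum_{n\ge2}a_nz^n$, $g(z)=\sum_{n\ge2}b_nz^n$. Define $$R_{\mathcal{C}}(r)=M_K(r)+|\alpha|\int_0^r tM_{K'}(t)\,dt,\qquad L(1,\alpha)=-K(-1)-|\alpha|\int_0^1 tK'(-t)\,dt,$$ and let $r_f$ be the smallest positive root of $R_{\mathcal{C}}(r)=L(1,\alpha)$. Then $$|z|+\sum_{n=2}^\infty(|a_n|+|b_n|)|z|^n\le d(f(0),\partial f(\mathbb{D}))$$ for $|z|=r\le\min\{1/3,r_f\}$.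
   Context: $\mathbb{D}=\{z\in\mathbb{C}:|z|<1\}$. A Ma-Minda function is an analytic univalent $\phi:\mathbb{D}\to\mathbb{C}$ such that $\phi(\mathbb{D})$ has positive real part, is symmetric with respect to the real axis, is starlike with respect to $\phi(0)=1$, and $\phi'(0)>0$. $F\prec G$ means $F=G\circ\omega$ for some analytic $\omega:\mathbb{D}\to\mathbb{D}$ with $\omega(0)=0$. $\mathcal{C}(\phi)$ is the class of univalent analytic $f$ on $\mathbb{D}$ with $f(0)=0,f'(0)=1$ and $1+zf''(z)/f'(z)\prec\phi(z)$. For $\alpha\in\mathbb{C}$ with $|\alpha|\le1$, $\mathcal{HC}(\phi)$ is the class of harmonic mappings $f=h+\overline{g}$ on $\mathbb{D}$ with $h(z)=z+\sum_{n\ge2}a_nz^n$, $g(z)=\sum_{n\ge2}b_nz^n$, $h\in\mathcal{C}(\phi)$ and $g'(z)=\alpha zh'(z)$. For an analytic $F(z)=\sum_{n\ge0}c_nz^n$, the majorant series is $M_F(r)=\sum_{n\ge0}|c_n|r^n$. $d(f(0),\partial f(\mathbb{D}))$ denotes the Euclidean distance from $f(0)$ to the boundary of $f(\mathbb{D})$. *)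

theory Defs
  imports "HOL-Analysis.Analysis"
begin

abbreviation unit_disc :: "complex set" where
  "unit_disc \<equiv> ball 0 1"

definition subordinate :: "(complex \<Rightarrow> complex) \<Rightarrow> (complex \<Rightarrow> complex) \<Rightarrow> bool" where
  "subordinate F G \<longleftrightarrow> (\<exists>\<omega>. \<omega> holomorphic_on unit_disc \<and> \<omega> ` unit_disc \<subseteq> unit_disc \<and>
      \<omega> 0 = 0 \<and> (\<forall>z\<in>unit_disc. F z = G (\<omega> z)))"

definition ma_minda :: "(complex \<Rightarrow> complex) \<Rightarrow> bool" where
  "ma_minda \<phi> \<longleftrightarrow> \<phi> holomorphic_on unit_disc \<and> inj_on \<phi> unit_disc \<and>
     (\<forall>z\<in>unit_disc. Re (\<phi> z) > 0) \<and>
     (\<forall>w\<in>\<phi> ` unit_disc. cnj w \<in> \<phi> ` unit_disc) \<and>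
     \<phi> 0 = 1 \<and>
     (\<forall>w\<in>\<phi> ` unit_disc. closed_segment 1 w \<subseteq> \<phi> ` unit_disc) \<and>
     deriv \<phi> 0 \<in> \<real> \<and> Re (deriv \<phi> 0) > 0"

definition convex_class :: "(complex \<Rightarrow> complex) \<Rightarrow> (complex \<Rightarrow> complex) \<Rightarrow> bool" where
  "convex_class \<phi> h \<longleftrightarrow> h holomorphic_on unit_disc \<and> inj_on h unit_disc \<and>
     h 0 = 0 \<and> deriv h 0 = 1 \<and>
     subordinate (\<lambda>z. 1 + z * deriv (deriv h) z / deriv h z) \<phi>"

definition coeff0 :: "(complex \<Rightarrow> complex) \<Rightarrow> nat \<Rightarrow> complex" where
  "coeff0 F n = (deriv ^^ n) F 0 / fact n"

definition majorant :: "(complex \<Rightarrow> complex) \<Rightarrow> real \<Rightarrow> real" where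
  "majorant F r = (\<Sum>n. norm (coeff0 F n) * r ^ n)"

end

theory Submission
  imports Defs "HOL-Complex_Analysis.Complex_Analysis"
begin

text \<open>Put \<open>q = \<phi> - 1\<close>, which is starlike, \<open>Q = log K'\<close> and \<open>P = log h'\<close>, so that \<open>z Q' = q\<close> and
  \<open>z P' = q \<circ> \<omega>\<close> for a Schwarz function \<open>\<omega>\<close>. As \<open>q\<close> is starlike, \<open>Q\<close> maps circles to convex curves, and
  Jack's lemma gives \<open>P = Q \<circ> W\<close>, that is, \<open>h' = K' \<circ> W\<close>, for a Schwarz function \<open>W\<close>. Two consequences:

  By Bohr's theorem the majorant series of \<open>h'\<close> is below that of \<open>K'\<close> up to radius \<open>1/3\<close>; integrating
  \<open>h'\<close> and \<open>g' = \<alpha> z h'\<close> bounds the left-hand side by \<open>R\<^sub>C r \<le> R\<^sub>C r\<^sub>f = L\<close>.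

  By symmetry and convexity the minimum of \<open>Re Q\<close> on \<open>\<bar>z\<bar> \<le> r\<close> is \<open>Q (-r)\<close>, so \<open>\<bar>h' z\<bar> \<ge> K'(-\<bar>z\<bar>)\<close>. As \<open>h\<close> is convex
  and \<open>\<bar>g'\<bar> < \<bar>h'\<bar>\<close>, the harmonic map \<open>f\<close> is univalent, and the preimage of the segment from \<open>0\<close> to the
  nearest boundary point of the image runs out to the unit circle. Its image therefore has length at
  least \<open>\<integral>\<^sub>0\<^sup>1 (1 - \<bar>\<alpha>\<bar> t) K'(-t) dt = L\<close>.\<close>

subsection \<open>Support lines of images of circles\<close>

lemma has_real_derivative_Re_along:
  fixes c :: "real \<Rightarrow> complex"
  assumes V: "V holomorphic_on S" "open S" and c: "(c has_vector_derivative c') (at t)" "c t \<in> S"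
  shows "((\<lambda>t. Re (V (c t))) has_real_derivative Re (c' * deriv V (c t))) (at t)"
proof -
  have "(V has_field_derivative deriv V (c t)) (at (c t))"
    using V c(2) by (simp add: holomorphic_derivI)
  from field_vector_diff_chain_at[OF c(1) this]
  have "((V \<circ> c) has_vector_derivative c' * deriv V (c t)) (at t)" .
  from bounded_linear.has_vector_derivative[OF bounded_linear_Re this]
  show ?thesis
    by (simp add: has_real_derivative_iff_has_vector_derivative o_def)
qed

lemma has_vector_derivative_cis:
  "((\<lambda>t. z * cis t) has_vector_derivative z * \<i> * cis t) (at t)"
proof -
  have "((\<lambda>x. z * exp (\<i> * x)) has_field_derivative z * \<i> * exp (\<i> * of_real t)) (at (of_real t))"
    by (auto intro!: derivative_eq_intros)
  from has_vector_derivative_real_field[OF this] show ?thesis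
    by (simp add: cis_conv_exp)
qed

text \<open>At a maximum the tangential derivative of \<open>Re V\<close>, minus the imaginary part
  of \<open>z1 * deriv V z1\<close>, vanishes. A negative radial derivative, the real part, would
  make \<open>Re V\<close> larger just inside the circle.\<close>

lemma Re_max_on_sphere:
  assumes V: "V holomorphic_on ball 0 R" and z1: "norm z1 = r" "0 < r" "r < R"
    and max: "\<And>z. norm z \<le> r \<Longrightarrow> Re (V z) \<le> Re (V z1)"
  shows "\<exists>m\<ge>0. z1 * deriv V z1 = of_real m"
proof -
  have z1b: "z1 \<in> ball 0 R" using z1 by auto
  have d1: "((\<lambda>t. Re (V (z1 * cis t))) has_real_derivative Re (z1 * \<i> * cis 0 * deriv V (z1 * cis 0))) (at 0)"
    by (rule has_real_derivative_Re_along[OF V open_ball])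
       (use z1b has_vector_derivative_cis[of z1 0] in auto)
  have mx: "\<forall>y. \<bar>0 - y\<bar> < 1 \<longrightarrow> Re (V (z1 * cis y)) \<le> Re (V (z1 * cis 0))"
    using max z1 by (auto simp: norm_mult)
  have "Re (z1 * \<i> * cis 0 * deriv V (z1 * cis 0)) = 0"
    by (rule DERIV_local_max[OF d1 zero_less_one mx])
  hence im: "Im (z1 * deriv V z1) = 0" by (simp add: algebra_simps)
  have d: "((\<lambda>t. Re (V (of_real t * z1))) has_real_derivative Re (z1 * deriv V (of_real 1 * z1))) (at 1)"
    by (rule has_real_derivative_Re_along[OF V open_ball])
       (use z1b in \<open>auto intro!: derivative_eq_intros simp: has_vector_derivative_def scaleR_conv_of_real\<close>)
  have "Re (z1 * deriv V z1) \<ge> 0"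
  proof (rule ccontr)
    assume "\<not> ?thesis"
    then obtain e where e: "e > 0" "\<And>h. 0 < h \<Longrightarrow> h < e \<Longrightarrow> Re (V (of_real 1 * z1)) < Re (V (of_real (1 - h) * z1))"
      using DERIV_neg_dec_left[OF d] by auto
    define h where "h = min (e/2) (1/2)"
    have "Re (V (of_real 1 * z1)) < Re (V (of_real (1 - h) * z1))" using e by (simp add: h_def)
    moreover have "norm (of_real (1 - h) * z1) \<le> 1 * r"
      unfolding norm_mult norm_of_real z1(1)
      by (rule mult_right_mono) (use e z1 in \<open>auto simp: h_def\<close>)
    ultimately show False using max[of "of_real (1 - h) * z1"] by simp
  qed
  thus ?thesis
    using im by (intro exI[of _ "Re (z1 * deriv V z1)"]) (auto simp: complex_eq_iff)
qed

text \<open>From an interior point a step along \<open>cnj (deriv V z1)\<close> changes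
  \<open>Re V\<close> at the rate of the squared modulus of the derivative, which is not 0. So the
  maximum lies on the circle, and the real factor found there cannot vanish.\<close>

lemma Re_max_on_cball:
  assumes V: "V holomorphic_on ball 0 1" and r: "r < 1" and z1: "norm z1 \<le> r"
    and max: "\<And>z. norm z \<le> r \<Longrightarrow> Re (V z) \<le> Re (V z1)" and nz: "deriv V z1 \<noteq> 0"
    and r0: "0 < r"
  shows "norm z1 = r" and "\<exists>m>0. z1 * deriv V z1 = of_real m"
proof -
  have z1b: "z1 \<in> ball 0 1" using z1 r by auto
  show eq: "norm z1 = r"
  proof (rule ccontr)
    assume "norm z1 \<noteq> r"
    with z1 have lt: "norm z1 < r" by simp
    define v where "v = cnj (deriv V z1)"
    have v0: "norm v > 0" using nz by (simp add: v_def)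
    have d: "((\<lambda>t. Re (V (z1 + of_real t * v))) has_real_derivative Re (v * deriv V (z1 + of_real 0 * v))) (at 0)"
      by (rule has_real_derivative_Re_along[OF V open_ball])
         (use z1b in \<open>auto intro!: derivative_eq_intros simp: has_vector_derivative_def scaleR_conv_of_real\<close>)
    have "Re (v * deriv V (z1 + of_real 0 * v)) = 0"
    proof (rule DERIV_local_max[OF d])
      show "0 < (r - norm z1) / norm v" using lt v0 by simp
      show "\<forall>y. \<bar>0 - y\<bar> < (r - norm z1) / norm v \<longrightarrow> Re (V (z1 + of_real y * v)) \<le> Re (V (z1 + of_real 0 * v))"
      proof (intro allI impI)
        fix y assume "\<bar>0 - y\<bar> < (r - norm z1) / norm v"
        hence "\<bar>y\<bar> * norm v < r - norm z1" using v0 by (simp add: field_simps)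
        hence "norm (z1 + of_real y * v) \<le> r"
          using norm_triangle_ineq[of z1 "of_real y * v"] by (simp add: norm_mult)
        thus "Re (V (z1 + of_real y * v)) \<le> Re (V (z1 + of_real 0 * v))" using max by simp
      qed
    qed
    hence "Re (v * cnj v) = 0" by (simp add: v_def)
    hence "(norm v)\<^sup>2 = 0" by (metis Re_complex_of_real complex_norm_square)
    thus False using v0 by simp
  qed
  have "\<exists>m\<ge>0. z1 * deriv V z1 = of_real m"
    by (rule Re_max_on_sphere[OF V eq r0 r max])
  moreover have "z1 * deriv V z1 \<noteq> 0" using nz eq r0 by auto
  ultimately show "\<exists>m>0. z1 * deriv V z1 = of_real m"
    by (metis of_real_0 order_le_less)
qed

text \<open>For \<open>q z = z * deriv Q z\<close>, the value \<open>q z\<close> is the outer normal at \<open>Q z\<close> of the image under \<open>Q\<close>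
  of the circle through \<open>z\<close>: no normal direction repeats along that curve.\<close>

definition circle_rays :: "(complex \<Rightarrow> complex) \<Rightarrow> bool" where
  "circle_rays q \<longleftrightarrow> (\<forall>z w. \<forall>c>0. norm z < 1 \<longrightarrow> norm z = norm w \<longrightarrow> q z = of_real c * q w \<longrightarrow> z = w)"

text \<open>Let \<open>u = w * deriv Q w\<close>. A maximiser of \<open>Re (cnj u * Q z)\<close> on
  the closed disc lies on the circle and has an outer normal that is a positive multiple of
  \<open>u\<close>. By \<open>rays\<close> only \<open>w\<close> qualifies, hence the strict
  inequality.\<close>

lemma circle_support:
  assumes Q: "Q holomorphic_on ball 0 1" and nz: "\<And>z. norm z < 1 \<Longrightarrow> deriv Q z \<noteq> 0"
    and rays: "circle_rays (\<lambda>z. z * deriv Q z)"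
    and w: "norm w < 1" "w \<noteq> 0" and z: "norm z \<le> norm w" "z \<noteq> w"
  shows "Re (cnj (w * deriv Q w) * Q z) < Re (cnj (w * deriv Q w) * Q w)"
proof -
  define u where "u = w * deriv Q w"
  define V where "V = (\<lambda>z. cnj u * Q z)"
  have u0: "u \<noteq> 0" using w nz by (simp add: u_def)
  have V: "V holomorphic_on ball 0 1" unfolding V_def by (intro holomorphic_intros Q)
  have dV: "deriv V z = cnj u * deriv Q z" if "norm z < 1" for z
    unfolding V_def using Q that
    by (intro deriv_cmult) (auto simp: holomorphic_on_imp_differentiable_at)
  have max: "z1 = w" if "norm z1 \<le> norm w" "\<And>z. norm z \<le> norm w \<Longrightarrow> Re (V z) \<le> Re (V z1)" for z1
  proof -
    have n: "norm z1 < 1" using that w by simp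
    have *: "norm z1 = norm w" "\<exists>m>0. z1 * deriv V z1 = of_real m"
      by (rule Re_max_on_cball[OF V _ that]; use w n u0 nz dV in simp)+
    then obtain m where m: "m > 0" "z1 * deriv V z1 = of_real m" by blast
    have "cnj u * (z1 * deriv Q z1) = of_real m" using m dV n by (simp add: algebra_simps)
    hence "z1 * deriv Q z1 = of_real m / cnj u" using u0 by (simp add: field_simps)
    also have "\<dots> = of_real (m / (norm u)\<^sup>2) * u"
      using u0 complex_norm_square[of u] by (simp add: field_simps)
    finally have "z1 * deriv Q z1 = of_real (m / (norm u)\<^sup>2) * (w * deriv Q w)" by (simp add: u_def)
    moreover have "m / (norm u)\<^sup>2 > 0" using m u0 by simp
    ultimately show "z1 = w" using rays *(1) n unfolding circle_rays_def by blast
  qed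
  have "continuous_on (cball 0 (norm w)) (\<lambda>z. Re (V z))"
    using V w by (intro continuous_intros holomorphic_on_imp_continuous_on)
       (auto elim!: holomorphic_on_subset)
  then obtain z0 where z0: "norm z0 \<le> norm w" "\<And>z. norm z \<le> norm w \<Longrightarrow> Re (V z) \<le> Re (V z0)"
    using continuous_attains_sup[OF compact_cball, of 0 "norm w" "\<lambda>z. Re (V z)"] by force
  from max[OF z0] have [simp]: "z0 = w" .
  have "Re (V z) \<noteq> Re (V w)"
    using max[OF z(1)] z z0(2) by auto
  thus ?thesis using z0(2)[OF z(1)] by (simp add: V_def u_def)
qed

text \<open>If two points shared an image, the one of larger modulus could serve as \<open>w\<close>
  in the strict support inequality.\<close>

lemma circle_support_inj:
  assumes Q: "Q holomorphic_on ball 0 1" and nz: "\<And>z. norm z < 1 \<Longrightarrow> deriv Q z \<noteq> 0"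
    and rays: "circle_rays (\<lambda>z. z * deriv Q z)"
  shows "inj_on Q (ball 0 1)"
proof -
  have "False" if "norm z \<le> norm w" "norm w < 1" "Q z = Q w" "z \<noteq> w" for z w
    using circle_support[OF assms that(2) _ that(1,4)] that by fastforce
  thus ?thesis unfolding inj_on_def by (metis dist_0_norm linear mem_ball)
qed

text \<open>If a convex combination \<open>m\<close> of points of \<open>C\<close> lay outside
  \<open>C\<close>, the segment from the interior point \<open>c\<close> to \<open>m\<close> would
  cross the frontier at some \<open>p\<close> before \<open>m\<close>. The supporting functional at
  \<open>p\<close> is strictly smaller at \<open>c\<close> and not larger at \<open>m\<close>, so it
  could not attain its value at \<open>p\<close> in between.\<close>

lemma convex_supported:
  fixes C :: "'a::euclidean_space set"
  assumes C: "closed C" and c: "c \<in> interior C"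
    and supp: "\<And>p. p \<in> frontier C \<Longrightarrow> \<exists>u. u \<noteq> 0 \<and> (\<forall>x\<in>C. inner u x \<le> inner u p)"
  shows "convex C"
proof (rule convexI)
  fix x y and a b :: real
  assume xy: "x \<in> C" "y \<in> C" and ab: "0 \<le> a" "0 \<le> b" "a + b = 1"
  define m where "m = a *\<^sub>R x + b *\<^sub>R y"
  show "a *\<^sub>R x + b *\<^sub>R y \<in> C"
  proof (rule ccontr)
    assume "a *\<^sub>R x + b *\<^sub>R y \<notin> C"
    hence mC: "m \<notin> C" by (simp add: m_def)
    have "closed_segment c m \<inter> frontier C \<noteq> {}"
      by (rule connected_Int_frontier) (use c mC interior_subset in auto)
    then obtain p where p: "p \<in> closed_segment c m" "p \<in> frontier C" by blast
    then obtain t where t: "0 \<le> t" "t \<le> 1" "p = (1 - t) *\<^sub>R c + t *\<^sub>R m"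
      by (auto simp: in_segment)
    have pC: "p \<in> C" using p C by (simp add: frontier_def)
    have t1: "t < 1" using t pC mC by (cases "t = 1") auto
    from supp[OF p(2)] obtain u where u: "u \<noteq> 0" "\<And>x. x \<in> C \<Longrightarrow> inner u x \<le> inner u p" by blast
    obtain e where e: "e > 0" "ball c e \<subseteq> C" using c by (auto simp: mem_interior)
    \<comment> \<open>Half the radius of the ball in the direction of \<open>u\<close>: this stays
      in \<open>C\<close> and makes the inequality at \<open>c\<close> strict.\<close>
    define c2 where "c2 = c + (e / (2 * norm u)) *\<^sub>R u"
    have "dist c c2 < e" using e u by (simp add: c2_def dist_norm)
    hence "inner u c2 \<le> inner u p" using e u(2) by auto
    moreover have "inner u c2 = inner u c + e / (2 * norm u) * inner u u"
      by (simp add: c2_def inner_add_right)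
    moreover have "e / (2 * norm u) * inner u u > 0" using e u by simp
    ultimately have c: "inner u c < inner u p" by linarith
    have "inner u m = a * inner u x + b * inner u y" by (simp add: m_def inner_add_right)
    also have "\<dots> \<le> a * inner u p + b * inner u p"
      by (intro add_mono mult_left_mono u xy ab)
    also have "\<dots> = inner u p" using ab by (metis distrib_right mult_1)
    finally have m: "inner u m \<le> inner u p" .
    have "inner u p = (1 - t) * inner u c + t * inner u m"
      by (simp add: t(3) inner_add_right)
    also have "\<dots> < (1 - t) * inner u p + t * inner u p"
      by (intro add_less_le_mono mult_strict_left_mono mult_left_mono) (use t t1 c m in auto)
    finally show False by (simp add: algebra_simps)
  qed
qed

text \<open>Injectivity makes the image of the open disc open, so every frontier point is
  \<open>Q w\<close> with \<open>norm w = r\<close>, and there \<open>w * deriv Q w\<close> is the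
  normal of a support line.\<close>

lemma circle_support_convex:
  assumes Q: "Q holomorphic_on ball 0 1" and nz: "\<And>z. norm z < 1 \<Longrightarrow> deriv Q z \<noteq> 0"
    and rays: "circle_rays (\<lambda>z. z * deriv Q z)" and r: "0 < r" "r < 1"
  shows "convex (Q ` cball 0 r)"
proof (rule convex_supported)
  have cont: "continuous_on (cball 0 r) Q"
    using Q r by (intro holomorphic_on_imp_continuous_on) (auto elim!: holomorphic_on_subset)
  show cl: "closed (Q ` cball 0 r)"
    by (intro compact_imp_closed compact_continuous_image cont compact_cball)
  have "open (Q ` ball 0 r)"
    by (rule open_mapping_thm3)
       (use Q r circle_support_inj[OF Q nz rays] in \<open>auto elim!: holomorphic_on_subset inj_on_subset\<close>)
  hence int: "Q ` ball 0 r \<subseteq> interior (Q ` cball 0 r)"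
    by (intro interior_maximal) auto
  thus "Q 0 \<in> interior (Q ` cball 0 r)" using r by (auto simp: image_subset_iff)
  fix p assume p: "p \<in> frontier (Q ` cball 0 r)"
  then obtain w where w: "p = Q w" "norm w \<le> r" using cl by (auto simp: frontier_def)
  have nw: "norm w = r" using p int w by (fastforce simp: frontier_def)
  hence w1: "norm w < 1" "w \<noteq> 0" using r by auto
  show "\<exists>u. u \<noteq> 0 \<and> (\<forall>x\<in>Q ` cball 0 r. inner u x \<le> inner u p)"
  proof (intro exI conjI ballI)
    show "w * deriv Q w \<noteq> 0" using nz w1 by simp
    fix x assume "x \<in> Q ` cball 0 r"
    then obtain z where z: "x = Q z" "norm z \<le> norm w" using nw by auto
    have "Re (cnj (w * deriv Q w) * Q z) \<le> Re (cnj (w * deriv Q w) * Q w)"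
      using circle_support[OF Q nz rays w1 z(2)] by (cases "z = w") auto
    thus "inner (w * deriv Q w) x \<le> inner (w * deriv Q w) p"
      by (simp add: z w cmod_def inner_complex_def algebra_simps)
  qed
qed

subsection \<open>Starlike functions and their logarithmic primitives\<close>

locale starlike_disc =
  fixes q :: "complex \<Rightarrow> complex"
  assumes holo: "q holomorphic_on ball 0 1" and inj: "inj_on q (ball 0 1)" and zero: "q 0 = 0"
    and star: "\<And>z t. norm z < 1 \<Longrightarrow> 0 \<le> t \<Longrightarrow> t \<le> 1 \<Longrightarrow> of_real t * q z \<in> q ` ball 0 1"
begin

text \<open>The map \<open>W\<close>, the inverse of \<open>q\<close> applied to
  \<open>t * q\<close>, is a Schwarz function. Equality in the Schwarz lemma would make it a
  rotation by some \<open>a\<close> of modulus 1, but comparing derivatives at 0 gives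
  \<open>a = t < 1\<close>.\<close>

lemma shrink:
  assumes w: "norm w < 1" "w \<noteq> 0" and t: "0 < t" "t < 1"
  obtains \<eta> where "norm \<eta> < norm w" "q \<eta> = of_real t * q w"
proof -
  obtain g where g: "g holomorphic_on q ` ball 0 1" "\<And>z. z \<in> ball 0 1 \<Longrightarrow> g (q z) = z"
    using holomorphic_has_inverse[OF holo open_ball inj] by metis
  define W where "W = (\<lambda>z. g (of_real t * q z))"
  have sub: "of_real t * q z \<in> q ` ball 0 1" if "norm z < 1" for z
    using star[OF that, of t] t by simp
  have W: "W holomorphic_on ball 0 1"
    unfolding W_def
    by (rule holomorphic_on_compose_gen[OF _ g(1), unfolded o_def])
       (use holo sub in \<open>auto intro!: holomorphic_intros\<close>)
  have qW: "q (W z) = of_real t * q z" and Wn: "norm (W z) < 1" if "norm z < 1" for z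
    using sub[OF that] g(2) by (auto simp: W_def)
  have W0: "W 0 = 0" using g(2)[of 0] zero by (simp add: W_def)
  note S = Schwarz_Lemma[OF W W0 Wn w(1)]
  have "norm (W w) \<noteq> norm w"
  proof
    assume "norm (W w) = norm w"
    then obtain a where a: "\<And>z. norm z < 1 \<Longrightarrow> W z = a * z" "norm a = 1"
      using S(3) w by blast
    have d0: "(q has_field_derivative deriv q 0) (at 0)"
      using holo by (intro holomorphic_derivI) auto
    have "((\<lambda>z. q (a * z)) has_field_derivative deriv q 0 * a) (at 0)"
      by (rule DERIV_chain2[of q _ "\<lambda>z. a * z"])
         (use d0 in \<open>auto intro!: derivative_eq_intros\<close>)
    moreover have "((\<lambda>z. q (a * z)) has_field_derivative of_real t * deriv q 0) (at 0)"
    proof (rule has_field_derivative_transform_within_open[OF _ open_ball])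
      show "((\<lambda>z. of_real t * q z) has_field_derivative of_real t * deriv q 0) (at 0)"
        using DERIV_cmult[OF d0] .
      show "0 \<in> ball (0::complex) 1" by simp
      show "of_real t * q z = q (a * z)" if "z \<in> ball 0 1" for z
        using qW[of z] a(1)[of z] that by simp
    qed
    ultimately have "deriv q 0 * a = of_real t * deriv q 0" by (rule DERIV_unique)
    hence "a = of_real t"
      using holomorphic_injective_imp_regular[OF holo open_ball inj, of 0] by simp
    thus False using a(2) t by simp
  qed
  with S(1) show ?thesis using qW[OF w(1)] by (intro that[of "W w"]) auto
qed

text \<open>For \<open>c < 1\<close> the value \<open>c * q w\<close> is also attained strictly
  inside the circle through \<open>w\<close>, against injectivity. The case \<open>c > 1\<close>
  follows by exchanging \<open>z\<close> and \<open>w\<close>.\<close>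

lemma rays: "circle_rays q"
  unfolding circle_rays_def
proof (intro allI impI)
  have *: False if "norm w < 1" "norm z = norm w" "q z = of_real c * q w" "0 < c" "c < 1" "z \<noteq> w" for z w c
  proof -
    have "w \<noteq> 0" using that by auto
    from shrink[OF that(1) this that(4,5)] obtain \<eta> where "norm \<eta> < norm w" "q \<eta> = of_real c * q w" .
    hence n: "norm \<eta> < norm w" "q \<eta> = q z" using that by auto
    hence "\<eta> = z" using inj that by (auto simp: inj_on_def)
    thus False using n that by simp
  qed
  fix z w :: complex and c :: real
  assume c: "0 < c" and n: "norm z < 1" "norm z = norm w" and e: "q z = of_real c * q w"
  have e': "q w = of_real (1 / c) * q z" using e c by simp
  consider "c = 1" | "c < 1" | "1 / c < 1" "0 < 1 / c" using c by fastforce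
  thus "z = w"
  proof cases
    case 1 thus ?thesis using e n inj by (auto simp: inj_on_def)
  next
    case 2 thus ?thesis using *[OF _ n(2) e c] n by auto
  next
    case 3 thus ?thesis using *[OF n(1) n(2)[symmetric] e'] by auto
  qed
qed

end

section \<open>Jack's lemma and subordination of logarithmic primitives\<close>

lemma cball_max_sphere:
  fixes U :: "complex \<Rightarrow> complex"
  assumes U: "U holomorphic_on ball 0 R" and r: "0 < r" "r < R"
  obtains z1 where "norm z1 = r" "\<And>z. norm z \<le> r \<Longrightarrow> norm (U z) \<le> norm (U z1)"
proof -
  have cont: "continuous_on (cball 0 r) U"
    using U r by (intro holomorphic_on_imp_continuous_on) (auto elim!: holomorphic_on_subset)
  have "continuous_on (sphere 0 r) (\<lambda>z. norm (U z))"
    by (intro continuous_intros continuous_on_subset[OF cont]) auto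
  then obtain z1 where z1: "norm z1 = r" "\<And>z. norm z = r \<Longrightarrow> norm (U z) \<le> norm (U z1)"
    using continuous_attains_sup[OF compact_sphere, of 0 r "\<lambda>z. norm (U z)"] r by force
  have "norm (U z) \<le> norm (U z1)" if "norm z \<le> r" for z
    by (rule maximum_modulus_frontier[of U "cball 0 r"])
       (use z1 that U r cont in \<open>auto elim!: holomorphic_on_subset\<close>)
  with z1 that show ?thesis by blast
qed

context starlike_disc
begin

text \<open>Jack's lemma: where \<open>\<bar>W z / z\<bar>\<close> is maximal on a circle, \<open>z W' / W\<close> is a real number \<open>m \<ge> 1\<close>. If
  \<open>W\<close> violated the bound there, \<open>q (\<omega> z) = m q (W z)\<close> with \<open>\<bar>\<omega> z\<bar> < \<bar>W z\<bar>\<close> would contradict starlikeness.\<close>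

lemma primitive_bound:
  assumes P: "P holomorphic_on ball 0 R" and R: "0 < R" "R \<le> 1"
    and W: "W holomorphic_on ball 0 R" "W 0 = 0" and Q: "Q holomorphic_on ball 0 1"
    and W1: "\<And>z. norm z < R \<Longrightarrow> norm (W z) < 1" and QW: "\<And>z. norm z < R \<Longrightarrow> Q (W z) = P z"
    and dQ: "\<And>z. norm z < 1 \<Longrightarrow> z * deriv Q z = q z"
    and dP: "\<And>z. norm z < 1 \<Longrightarrow> z * deriv P z = q (\<omega> z)"
    and \<omega>: "\<And>z. norm z < 1 \<Longrightarrow> norm (\<omega> z) \<le> norm z"
    and z: "norm z < R"
  shows "norm (W z) \<le> norm z"
proof (rule ccontr)
  assume bad: "\<not> norm (W z) \<le> norm z"
  hence z0: "z \<noteq> 0" using W by auto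
  define U where "U = (\<lambda>z. if z = 0 then deriv W 0 else W z / z)"
  have U: "U holomorphic_on ball 0 R"
    by (rule pole_theorem_0[OF W(1), of 0]) (use R W in \<open>auto simp: U_def\<close>)
  have WU: "W z = z * U z" for z using W by (simp add: U_def)
  obtain z1 where z1: "norm z1 = norm z" "\<And>y. norm y \<le> norm z \<Longrightarrow> norm (U y) \<le> norm (U z1)"
    using cball_max_sphere[OF U, of "norm z"] z z0 by auto
  have z1': "z1 \<noteq> 0" "norm z1 < R" "norm z1 < 1" using z1 z0 z R by auto
  have "norm (U z) > 1" using bad z0 by (simp add: U_def norm_divide field_simps)
  hence U1: "norm (U z1) > 1" using z1(2)[of z] by simp
  hence big: "norm z1 < norm (W z1)" using z1' by (simp add: WU norm_mult)
  \<comment> \<open>The factor \<open>cnj (U z1)\<close> turns a maximum of the modulus of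
    \<open>U\<close> at \<open>z1\<close> into a maximum of a real part.\<close>
  define V where "V = (\<lambda>y. cnj (U z1) * U y)"
  have V: "V holomorphic_on ball 0 R" unfolding V_def by (intro holomorphic_intros U)
  have "\<exists>m\<ge>0. z1 * deriv V z1 = of_real m"
  proof (rule Re_max_on_sphere[OF V refl])
    fix y :: complex assume "norm y \<le> norm z1"
    hence "norm (U y) \<le> norm (U z1)" using z1 by simp
    have "Re (V y) \<le> norm (U z1) * norm (U y)"
      using complex_Re_le_cmod[of "V y"] by (simp add: V_def norm_mult)
    also have "\<dots> \<le> (norm (U z1))\<^sup>2"
      using \<open>norm (U y) \<le> norm (U z1)\<close> by (simp add: power2_eq_square mult_left_mono)
    also have "\<dots> = Re (V z1)"
      unfolding V_def by (metis Re_complex_of_real complex_norm_square mult.commute)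
    finally show "Re (V y) \<le> Re (V z1)" .
  qed (use z1' in auto)
  then obtain k where k: "k \<ge> 0" "z1 * deriv V z1 = of_real k" by blast
  have dU: "(U has_field_derivative deriv U z1) (at z1)"
    using U z1' by (intro holomorphic_derivI) auto
  have "deriv V z1 = cnj (U z1) * deriv U z1"
    unfolding V_def using dU by (intro DERIV_imp_deriv DERIV_cmult)
  hence k': "cnj (U z1) * (z1 * deriv U z1) = of_real k" using k by (simp add: algebra_simps)
  \<comment> \<open>Dividing \<open>k'\<close> by the squared modulus of \<open>U z1\<close> gives
    \<open>z1 * U' / U = m - 1\<close> at \<open>z1\<close>. As \<open>W z = z * U z\<close>, this
    means \<open>z1 * W' / W = m\<close>.\<close>
  define m where "m = 1 + k / (norm (U z1))\<^sup>2"
  have m: "m \<ge> 1" using k by (simp add: m_def)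
  have U0: "U z1 \<noteq> 0" using U1 by auto
  have "z1 * deriv U z1 = of_real k / cnj (U z1)" using k' U0 by (simp add: field_simps)
  also have "\<dots> = of_real (m - 1) * U z1"
    using U0 complex_norm_square[of "U z1"] by (simp add: m_def field_simps)
  finally have zU: "z1 * deriv U z1 = of_real (m - 1) * U z1" .
  have dW: "(W has_field_derivative U z1 + z1 * deriv U z1) (at z1)"
    unfolding WU[abs_def] by (auto intro!: derivative_eq_intros dU)
  have dQ': "(Q has_field_derivative deriv Q (W z1)) (at (W z1))"
    using Q W1 z1' by (intro holomorphic_derivI) auto
  have "((\<lambda>y. Q (W y)) has_field_derivative deriv Q (W z1) * (U z1 + z1 * deriv U z1)) (at z1)"
    using DERIV_chain2[OF dQ' dW] .
  hence "(P has_field_derivative deriv Q (W z1) * (U z1 + z1 * deriv U z1)) (at z1)"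
    by (rule has_field_derivative_transform_within_open[OF _ open_ball[of 0 R]]) (use z1' QW in auto)
  hence "deriv P z1 = deriv Q (W z1) * (U z1 + z1 * deriv U z1)" by (rule DERIV_imp_deriv)
  also have "\<dots> = deriv Q (W z1) * (of_real m * U z1)" by (simp add: zU algebra_simps)
  finally have "z1 * deriv P z1 = of_real m * (W z1 * deriv Q (W z1))" by (simp add: WU)
  hence eq: "q (\<omega> z1) = of_real m * q (W z1)" using dP dQ W1 z1' by simp
  hence eq': "of_real (1 / m) * q (\<omega> z1) = q (W z1)" using m by simp
  have om: "norm (\<omega> z1) < norm (W z1)" "norm (\<omega> z1) < 1" using \<omega>[of z1] big z1' by auto
  have inj': "a = b" if "q a = q b" "norm a < 1" "norm b < 1" for a b
    using inj that by (auto simp: inj_on_def)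
  show False
  \<comment> \<open>\<open>shrink\<close> needs a factor strictly below 1 and a nonzero point. In
    the remaining cases \<open>q\<close> takes equal values at \<open>\<omega> z1\<close> and
    \<open>W z1\<close> directly.\<close>
  proof (cases "m = 1 \<or> \<omega> z1 = 0")
    case True
    hence "q (\<omega> z1) = q (W z1)" using eq' zero by auto
    hence "\<omega> z1 = W z1" using inj' om W1 z1' by blast
    thus False using om by simp
  next
    case False
    then obtain \<eta> where "norm \<eta> < norm (\<omega> z1)" "q \<eta> = of_real (1 / m) * q (\<omega> z1)"
      using shrink[of "\<omega> z1" "1 / m"] om m by auto
    hence "norm \<eta> < norm (\<omega> z1)" "q \<eta> = q (W z1)" using eq' by auto
    moreover from this have "\<eta> = W z1" using inj' om W1 z1' by auto
    ultimately show False using om by simp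
  qed
qed

text \<open>The candidate is the inverse of \<open>Q\<close> applied to \<open>P\<close>, which
  makes sense only while \<open>P\<close> stays in the image of \<open>Q\<close>. If
  \<open>P\<close> ever left it, let \<open>z0\<close> be an exit point of least modulus
  \<open>R\<close>. On the disc of radius \<open>R\<close> the bound
  \<open>norm (W z) \<le> norm z\<close> holds already, which keeps \<open>P\<close> inside a
  compact part of the image and so rules out an exit at \<open>z0\<close>.\<close>

lemma primitive_subordinate:
  assumes P: "P holomorphic_on ball 0 1" "P 0 = 0" and Q: "Q holomorphic_on ball 0 1" "Q 0 = 0"
    and injQ: "inj_on Q (ball 0 1)"
    and dQ: "\<And>z. norm z < 1 \<Longrightarrow> z * deriv Q z = q z"
    and dP: "\<And>z. norm z < 1 \<Longrightarrow> z * deriv P z = q (\<omega> z)"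
    and \<omega>: "\<And>z. norm z < 1 \<Longrightarrow> norm (\<omega> z) \<le> norm z"
  obtains W where "W holomorphic_on ball 0 1" "W 0 = 0"
    "\<And>z. norm z < 1 \<Longrightarrow> norm (W z) \<le> norm z" "\<And>z. norm z < 1 \<Longrightarrow> Q (W z) = P z"
proof -
  obtain g where g: "g holomorphic_on Q ` ball 0 1" "\<And>z. z \<in> ball 0 1 \<Longrightarrow> g (Q z) = z"
    using holomorphic_has_inverse[OF Q(1) open_ball injQ] by metis
  define W where "W = (\<lambda>z. g (P z))"
  have W0: "W 0 = 0" using g(2)[of 0] P Q by (simp add: W_def)
  have step: "W holomorphic_on ball 0 R \<and> (\<forall>z\<in>ball 0 R. norm (W z) \<le> norm z \<and> Q (W z) = P z)"
    if sub: "P ` ball 0 R \<subseteq> Q ` ball 0 1" and R: "0 < R" "R \<le> 1" for R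
  proof -
    have PR: "P holomorphic_on ball 0 R" using P(1) R by (auto elim!: holomorphic_on_subset)
    have WR: "W holomorphic_on ball 0 R"
      unfolding W_def by (rule holomorphic_on_compose_gen[OF PR g(1) sub, unfolded o_def])
    have QW: "norm (W z) < 1" "Q (W z) = P z" if "norm z < R" for z
    proof -
      have "P z \<in> Q ` ball 0 1" using sub that by auto
      thus "norm (W z) < 1" "Q (W z) = P z" using g(2) by (auto simp: W_def)
    qed
    have "norm (W z) \<le> norm z" if "norm z < R" for z
      by (rule primitive_bound[OF PR R WR W0 Q(1) QW dQ dP \<omega> that])
    thus ?thesis using WR QW by auto
  qed
  have sub: "P ` ball 0 1 \<subseteq> Q ` ball 0 1"
  proof (rule ccontr)
    assume "\<not> ?thesis"
    then obtain z3 where "z3 \<in> ball 0 1" and z3: "P z3 \<notin> Q ` ball 0 1" by blast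
    hence z3: "norm z3 < 1" "P z3 \<notin> Q ` ball 0 1" by auto
    define B where "B = cball 0 (norm z3) \<inter> P -` (- (Q ` ball 0 1))"
    have "open (Q ` ball 0 1)" by (rule open_mapping_thm3[OF Q(1) open_ball injQ])
    moreover have cP: "continuous_on (ball 0 1) P" using P by (intro holomorphic_on_imp_continuous_on)
    ultimately have "closed B"
      unfolding B_def using z3
      by (intro continuous_closed_preimage continuous_on_subset[OF cP]) auto
    moreover have "bounded B" unfolding B_def using bounded_Int bounded_cball by blast
    ultimately have "compact B" by (simp add: compact_eq_bounded_closed)
    moreover have "z3 \<in> B" using z3 by (simp add: B_def)
    ultimately obtain z0 where z0: "z0 \<in> B" "\<And>z. z \<in> B \<Longrightarrow> norm z0 \<le> norm z"
      using continuous_attains_inf[of B norm] by (auto intro: continuous_intros)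
    define R where "R = norm z0"
    have Pz0: "P z0 \<notin> Q ` ball 0 1" "norm z0 \<le> norm z3" using z0(1) by (auto simp: B_def)
    hence Pz0: "P z0 \<notin> Q ` ball 0 1" "R < 1" using z3 by (auto simp: R_def)
    have "z0 \<noteq> 0" using Pz0 P Q by force
    hence R: "0 < R" "R < 1" using Pz0 by (auto simp: R_def)
    have "P ` ball 0 R \<subseteq> Q ` ball 0 1"
    proof
      fix y assume "y \<in> P ` ball 0 R"
      then obtain z where z: "norm z < R" "y = P z" by auto
      show "y \<in> Q ` ball 0 1"
      proof (rule ccontr)
        assume "y \<notin> Q ` ball 0 1"
        hence "z \<in> B" using z z0 by (auto simp: B_def R_def)
        thus False using z0(2)[of z] z by (simp add: R_def)
      qed
    qed
    from step[OF this] R have "\<forall>z\<in>ball 0 R. norm (W z) \<le> norm z \<and> Q (W z) = P z" by auto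
    hence "P ` ball 0 R \<subseteq> Q ` cball 0 R"
      by (smt (verit) dist_0_norm image_iff image_subsetI mem_ball mem_cball)
    moreover have "closed (Q ` cball 0 R)"
      using Q(1) R by (intro compact_imp_closed compact_continuous_image compact_cball
          holomorphic_on_imp_continuous_on) (auto elim!: holomorphic_on_subset)
    \<comment> \<open>Closedness of the image of the closed disc carries the inclusion over to the
      boundary circle, which contains \<open>z0\<close>.\<close>
    ultimately have "P ` closure (ball 0 R) \<subseteq> Q ` cball 0 R"
      by (intro image_closure_subset continuous_on_subset[OF cP]) (use R in auto)
    hence "P z0 \<in> Q ` cball 0 R" using R by (auto simp: R_def)
    thus False using Pz0 R by auto
  qed
  from step[OF this] show ?thesis by (intro that[of W] W0) auto
qed

end

section \<open>Logarithms of derivatives and convexity\<close>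

text \<open>A zero-free function on the disc has a logarithm, and subtracting its value at 0 is
  harmless because \<open>F 0 = 1\<close>. With \<open>F\<close> the derivative of \<open>K\<close>
  or \<open>h\<close>, the logarithmic derivative is the quotient in the definition of the convex
  class.\<close>

lemma exp_primitive:
  assumes F: "F holomorphic_on ball 0 1" "F 0 = 1" and nz: "\<And>z. norm z < 1 \<Longrightarrow> F z \<noteq> 0"
  obtains P where "P holomorphic_on ball 0 1" "P 0 = 0"
    "\<And>z. norm z < 1 \<Longrightarrow> F z = exp (P z)" "\<And>z. norm z < 1 \<Longrightarrow> deriv P z = deriv F z / F z"
proof -
  obtain G where G: "G holomorphic_on ball 0 1" "\<And>z. z \<in> ball 0 1 \<Longrightarrow> exp (G z) = F z"
    using holomorphic_logarithm_exists[OF convex_ball open_ball F(1), of 0] nz by auto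
  define P where "P = (\<lambda>z. G z - G 0)"
  have P: "P holomorphic_on ball 0 1" unfolding P_def by (intro holomorphic_intros G)
  have eP: "F z = exp (P z)" if "norm z < 1" for z
    using that G(2)[of z] G(2)[of 0] F(2) by (simp add: P_def exp_diff)
  have "deriv P z = deriv F z / F z" if z: "norm z < 1" for z
  proof -
    have dP: "(P has_field_derivative deriv P z) (at z)"
      using P z by (intro holomorphic_derivI) auto
    have "((\<lambda>z. exp (P z)) has_field_derivative exp (P z) * deriv P z) (at z)"
      by (auto intro!: derivative_eq_intros dP)
    hence "(F has_field_derivative exp (P z) * deriv P z) (at z)"
      by (rule has_field_derivative_transform_within_open[OF _ open_ball[of 0 1]]) (use z eP in auto)
    hence "deriv F z = F z * deriv P z" using eP z by (auto dest: DERIV_imp_deriv)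
    thus ?thesis using nz z by simp
  qed
  with P eP show ?thesis by (intro that[of P]) (auto simp: P_def)
qed

text \<open>\<open>T\<close> in the proof is a continuous branch of the argument of \<open>z h'(z)\<close> along a circle: it increases
  strictly, by \<open>2\<pi>\<close> in one turn.\<close>

lemma convex_rays:
  assumes h: "h holomorphic_on ball 0 1" "deriv h 0 = 1" and nz: "\<And>z. norm z < 1 \<Longrightarrow> deriv h z \<noteq> 0"
    and pos: "\<And>z. norm z < 1 \<Longrightarrow> Re (1 + z * deriv (deriv h) z / deriv h z) > 0"
  shows "circle_rays (\<lambda>z. z * deriv h z)"
  unfolding circle_rays_def
proof (intro allI impI)
  fix z w :: complex and c :: real
  assume c: "0 < c" and n: "norm z < 1" "norm z = norm w"
    and eq: "z * deriv h z = of_real c * (w * deriv h w)"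
  have dh: "deriv h holomorphic_on ball 0 1" using h by (intro holomorphic_deriv) auto
  from exp_primitive[OF dh h(2) nz] obtain P where P: "P holomorphic_on ball 0 1" "P 0 = 0"
    "\<And>z. norm z < 1 \<Longrightarrow> deriv h z = exp (P z)"
    "\<And>z. norm z < 1 \<Longrightarrow> deriv P z = deriv (deriv h) z / deriv h z"
    by auto
  show "z = w"
  proof (cases "w = 0")
    case True thus ?thesis using n by simp
  next
    case False
    define \<theta> where "\<theta> = Arg2pi (z / w)"
    have \<theta>: "0 \<le> \<theta>" "\<theta> < 2 * pi" using Arg2pi_ge_0 Arg2pi_lt_2pi by (auto simp: \<theta>_def)
    have "z / w = of_real (norm (z / w)) * exp (\<i> * of_real \<theta>)"
      unfolding \<theta>_def by (rule Arg2pi_eq)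
    hence zw: "z = w * cis \<theta>" using False n by (simp add: norm_divide cis_conv_exp field_simps)
    define T where "T = (\<lambda>t. t + Re (- \<i> * P (w * cis t)))"
    have dT: "\<exists>y. (T has_real_derivative y) (at t) \<and> y > 0" for t
    proof (intro exI conjI)
      let ?x = "w * cis t"
      have x: "norm ?x < 1" using n by (simp add: norm_mult)
      have "((\<lambda>t. Re (- \<i> * P (w * cis t))) has_real_derivative Re (w * \<i> * cis t * deriv (\<lambda>z. - \<i> * P z) ?x)) (at t)"
        by (rule has_real_derivative_Re_along[where S = "ball 0 1"])
           (use x P has_vector_derivative_cis[of w t] in \<open>auto intro!: holomorphic_intros\<close>)
      also have "deriv (\<lambda>z. - \<i> * P z) ?x = - \<i> * deriv P ?x"
        using P(1) x by (intro deriv_cmult) (auto simp: holomorphic_on_imp_differentiable_at)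
      finally show "(T has_real_derivative 1 + Re (w * \<i> * cis t * (- \<i> * deriv P ?x))) (at t)"
        unfolding T_def by (intro DERIV_add DERIV_ident)
      have "w * \<i> * cis t * (- \<i> * deriv P ?x) = ?x * deriv (deriv h) ?x / deriv h ?x"
        using P(4)[OF x] by (simp add: algebra_simps)
      thus "1 + Re (w * \<i> * cis t * (- \<i> * deriv P ?x)) > 0" using pos[OF x] by simp
    qed
    have mono: "T a < T b" if "a < b" for a b
      using DERIV_pos_imp_increasing[OF that] dT by blast
    \<comment> \<open>\<open>P\<close> returns to its value after a full turn, so the increase comes
      from the summand \<open>t\<close> alone.\<close>
    have T2: "T (2 * pi) = T 0 + 2 * pi" by (simp add: T_def)
    have nw: "norm w < 1" using n by simp
    \<comment> \<open>A positive factor \<open>c\<close> contributes no argument, so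
      \<open>T \<theta> - T 0\<close> is a multiple of a full turn. Monotonicity of \<open>T\<close>
      leaves only \<open>\<theta> = 0\<close>.\<close>
    have "w * cis \<theta> * exp (P z) = of_real c * (w * exp (P w))"
      using eq P(3)[OF n(1)] P(3)[OF nw] zw by simp
    hence "exp (\<i> * of_real \<theta> + P z - P w) = exp (of_real (ln c))"
      using False c by (simp add: exp_add exp_diff cis_conv_exp field_simps exp_of_real)
    then obtain k :: int where "\<i> * of_real \<theta> + P z - P w = of_real (ln c) + (of_int (2 * k) * pi) * \<i>"
      unfolding exp_eq by blast
    hence "Im (\<i> * of_real \<theta> + P z - P w) = Im (of_real (ln c) + (of_int (2 * k) * pi) * \<i>)" by simp
    hence k: "T \<theta> - T 0 = of_int k * (2 * pi)" using zw by (simp add: T_def)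
    have "\<theta> = 0"
    proof (rule ccontr)
      assume "\<theta> \<noteq> 0"
      hence "T 0 < T \<theta>" "T \<theta> < T (2 * pi)" using mono \<theta> by auto
      hence "0 < of_int k * (2 * pi)" "of_int k * (2 * pi) < 1 * (2 * pi)" using k T2 by linarith+
      hence "0 < k" "of_int k < (1::real)"
        by (simp_all add: zero_less_mult_iff mult_less_cancel_right)
      thus False by linarith
    qed
    thus ?thesis using zw by simp
  qed
qed

section \<open>Behaviour on the real axis and support lines of the primitive\<close>

text \<open>The reflected function \<open>qc\<close> has values in the image of \<open>q\<close>, so
  \<open>qc = q o W\<close> for a Schwarz function \<open>W\<close>. As the derivative of
  \<open>q\<close> at 0 is real and nonzero, that of \<open>W\<close> is 1, and the Schwarz lemma
  forces \<open>W\<close> to be the identity.\<close>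

lemma univalent_reflection:
  assumes q: "q holomorphic_on ball 0 1" "inj_on q (ball 0 1)"
    and sym: "\<And>w. w \<in> q ` ball 0 1 \<Longrightarrow> cnj w \<in> q ` ball 0 1"
    and real: "cnj (q 0) = q 0" "cnj (deriv q 0) = deriv q 0" and z: "norm z < 1"
  shows "q (cnj z) = cnj (q z)"
proof -
  obtain g where g: "g holomorphic_on q ` ball 0 1" "\<And>z. z \<in> ball 0 1 \<Longrightarrow> g (q z) = z"
    using holomorphic_has_inverse[OF q(1) open_ball q(2)] by metis
  define qc where "qc = (\<lambda>z. cnj (q (cnj z)))"
  have qc: "qc holomorphic_on ball 0 1"
  proof -
    have "cnj \<circ> q \<circ> cnj holomorphic_on ball 0 1"
      by (rule holomorphic_on_compose_cnj_cnj) (use q(1) in \<open>auto elim!: holomorphic_on_subset\<close>)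
    thus ?thesis by (simp add: qc_def o_def)
  qed
  have sub: "qc ` ball 0 1 \<subseteq> q ` ball 0 1" using sym by (auto simp: qc_def)
  define W where "W = (\<lambda>z. g (qc z))"
  have W: "W holomorphic_on ball 0 1"
    unfolding W_def by (rule holomorphic_on_compose_gen[OF qc g(1) sub, unfolded o_def])
  have qW: "q (W z) = qc z" and Wn: "norm (W z) < 1" if "norm z < 1" for z
  proof -
    have "qc z \<in> q ` ball 0 1" using sub that by auto
    thus "q (W z) = qc z" "norm (W z) < 1" using g(2) by (auto simp: W_def)
  qed
  have W0: "W 0 = 0" using g(2)[of 0] real by (simp add: W_def qc_def)
  have q0: "deriv q 0 \<noteq> 0" using holomorphic_injective_imp_regular[OF q(1) open_ball q(2), of 0] by simp
  have d0: "(q has_field_derivative deriv q 0) (at 0)"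
    using q(1) by (intro holomorphic_derivI) auto
  have dW: "(W has_field_derivative deriv W 0) (at 0)"
    using W by (intro holomorphic_derivI) auto
  have "(qc has_field_derivative cnj (deriv q 0)) (at 0)"
    using has_field_derivative_cnj_cnj[of q "deriv q 0" 0] d0 by (simp add: qc_def o_def)
  moreover have "(qc has_field_derivative deriv q 0 * deriv W 0) (at 0)"
    by (rule has_field_derivative_transform_within_open[OF DERIV_chain2[of q _ W] open_ball[of 0 1]])
       (use d0 dW W0 qW in auto)
  ultimately have "deriv q 0 * deriv W 0 = deriv q 0" using real DERIV_unique by metis
  hence W1: "deriv W 0 = 1" using q0 by simp
  then obtain a where a: "\<And>z. norm z < 1 \<Longrightarrow> W z = a * z"
    using Schwarz_Lemma(3)[OF W W0 Wn z] by auto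
  have "((\<lambda>z. a * z) has_field_derivative a) (at 0)" by (auto intro!: derivative_eq_intros)
  hence "(W has_field_derivative a) (at 0)"
    by (rule has_field_derivative_transform_within_open[OF _ open_ball[of 0 1]]) (use a in auto)
  hence "a = 1" using W1 DERIV_imp_deriv by metis
  hence "q z = qc z" using a qW z by force
  thus ?thesis by (simp add: qc_def)
qed

text \<open>On the real axis \<open>q\<close> is real and, by injectivity, vanishes only at 0. It is
  negative just left of 0 because its derivative there has positive real part, and by the
  intermediate value theorem it keeps this sign.\<close>

lemma negative_axis:
  assumes q: "q holomorphic_on ball 0 1" "inj_on q (ball 0 1)" "q 0 = 0" "Re (deriv q 0) > 0"
    and real: "\<And>z. norm z < 1 \<Longrightarrow> q (cnj z) = cnj (q z)" and r: "0 < r" "r < 1"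
  shows "\<exists>m>0. q (- of_real r) = - of_real m"
proof -
  have im: "Im (q (- of_real t)) = 0" if "\<bar>t\<bar> < 1" for t
    using real[of "- of_real t"] that by (simp add: complex_eq_iff)
  define f where "f = (\<lambda>t. Re (q (- of_real t)))"
  have nz: "f t \<noteq> 0" if "0 < t" "t < 1" for t
  proof
    assume "f t = 0"
    hence "q (- of_real t) = q 0" using im[of t] that q by (simp add: f_def complex_eq_iff)
    hence "- of_real t = (0::complex)" by (rule inj_onD[OF q(2)]) (use that in auto)
    thus False using that by simp
  qed
  have "(f has_real_derivative Re (- 1 * deriv q (- of_real 0))) (at 0)"
    unfolding f_def by (rule has_real_derivative_Re_along[OF q(1) open_ball])
      (auto intro!: derivative_eq_intros simp: has_vector_derivative_def scaleR_conv_of_real)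
  from DERIV_neg_dec_right[OF this] obtain d where d: "d > 0" "\<And>h. 0 < h \<Longrightarrow> h < d \<Longrightarrow> f h < f 0"
    using q(4) by auto
  define h where "h = min (d/2) (r/2)"
  have h: "0 < h" "h < d" "h < r" using d r by (auto simp: h_def)
  have fh: "f h < 0" using d(2)[OF h(1,2)] q by (simp add: f_def)
  have "continuous_on {h..r} f"
    unfolding f_def using h r
    by (intro continuous_intros continuous_on_compose2[OF holomorphic_on_imp_continuous_on[OF q(1)]]) auto
  hence "f r < 0"
    using IVT'[of f h 0 r] fh h nz r by (smt (verit, best))
  thus ?thesis using im[of r] r
    by (intro exI[of _ "- f r"]) (auto simp: f_def complex_eq_iff)
qed

text \<open>The outer normals \<open>z * deriv Q z\<close> are the values of \<open>q\<close>, and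
  starlikeness says that no direction repeats on a circle. Away from 0 the derivative of
  \<open>Q\<close> is nonzero because \<open>q\<close> is; at 0 this is \<open>dQ0\<close>.\<close>

lemma (in starlike_disc) primitive_inj_Re:
  assumes Q: "Q holomorphic_on ball 0 1"
    and dQ: "\<And>z. norm z < 1 \<Longrightarrow> z * deriv Q z = q z" and dQ0: "deriv Q 0 \<noteq> 0"
  shows "inj_on Q (ball 0 1)"
    and "\<And>w z. norm w < 1 \<Longrightarrow> w \<noteq> 0 \<Longrightarrow> norm z \<le> norm w \<Longrightarrow> Re (cnj (q w) * Q z) \<le> Re (cnj (q w) * Q w)"
proof -
  have nz: "deriv Q z \<noteq> 0" if "norm z < 1" for z
  proof (cases "z = 0")
    case False
    hence "q z \<noteq> 0" using inj zero that by (force simp: inj_on_def)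
    thus ?thesis using dQ[OF that] by auto
  qed (use dQ0 in auto)
  have rays': "circle_rays (\<lambda>z. z * deriv Q z)"
    using rays dQ unfolding circle_rays_def by metis
  show "inj_on Q (ball 0 1)" by (rule circle_support_inj[OF Q nz rays'])
  show "Re (cnj (q w) * Q z) \<le> Re (cnj (q w) * Q w)" if "norm w < 1" "w \<noteq> 0" "norm z \<le> norm w" for w z
    using circle_support[OF Q nz rays' that] dQ[OF that(1)] by (cases "z = w") auto
qed

subsection \<open>Bohr phenomenon for subordinate functions\<close>

text \<open>Cauchy's coefficient formula and Cauchy's theorem, written as Fourier integrals over
  \<open>{0..1}\<close>: the derivative of the circle path is \<open>2 * pi * \<i>\<close> times the
  path, which absorbs one power of \<open>p x\<close>.\<close>

lemma circle_has_integral: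
  assumes F: "F holomorphic_on ball 0 1" and r: "0 < r" "r < 1"
  defines "p \<equiv> circlepath 0 r"
  shows "((\<lambda>x. F (p x) / p x ^ n) has_integral coeff0 F n) {0..1}"
    and "((\<lambda>x. F (p x) * p x ^ Suc n) has_integral 0) {0..1}"
proof -
  have p0: "p x \<noteq> 0" for x using r by (simp add: p_def circlepath)
  have cont: "continuous_on (cball 0 r) F" and holo: "F holomorphic_on ball 0 r"
    using F r by (auto intro!: holomorphic_on_imp_continuous_on elim!: holomorphic_on_subset)
  have vd: "vector_derivative p (at x within {0..1}) = 2 * pi * \<i> * p x" if "x \<in> {0..1}" for x
    using that by (simp add: p_def vector_derivative_circlepath01) (simp add: circlepath)
  have "((\<lambda>u. F u / (u - 0) ^ Suc n) has_contour_integral (2 * pi * \<i>) / fact n * (deriv ^^ n) F 0) p"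
    unfolding p_def by (rule Cauchy_has_contour_integral_higher_derivative_circlepath[OF cont holo]) (use r in auto)
  hence "((\<lambda>x. F (p x) / p x ^ Suc n * (2 * pi * \<i> * p x)) has_integral (2 * pi * \<i>) * coeff0 F n) {0..1}"
    unfolding has_contour_integral_def
    by (rule has_integral_eq_rhs[OF has_integral_eq, rotated]) (simp_all add: vd coeff0_def)
  from has_integral_mult_right[OF this, of "1 / (2 * pi * \<i>)"]
  show "((\<lambda>x. F (p x) / p x ^ n) has_integral coeff0 F n) {0..1}"
    by (rule has_integral_eq_rhs[OF has_integral_eq, rotated]) (use p0 in \<open>simp_all add: field_simps\<close>)
  have "((\<lambda>u. F u * u ^ n) has_contour_integral 0) p"
    unfolding p_def
    by (rule Cauchy_theorem_convex_simple[of _ "ball 0 1"])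
       (use F r in \<open>auto intro!: holomorphic_intros simp: path_image_circlepath\<close>)
  hence "((\<lambda>x. F (p x) * p x ^ n * (2 * pi * \<i> * p x)) has_integral 0) {0..1}"
    unfolding has_contour_integral_def
    by (rule has_integral_eq[rotated]) (simp add: vd)
  from has_integral_mult_right[OF this, of "1 / (2 * pi * \<i>)"]
  show "((\<lambda>x. F (p x) * p x ^ Suc n) has_integral 0) {0..1}"
    by (rule has_integral_eq_rhs[OF has_integral_eq, rotated]) (use p0 in \<open>simp_all add: field_simps\<close>)
qed

text \<open>The antianalytic part of \<open>2 Re F = F + cnj F\<close> has no \<open>n\<close>-th Fourier coefficient on circles.\<close>

lemma coeff0_Re_nonneg:
  assumes F: "F holomorphic_on ball 0 1" and pos: "\<And>z. norm z < 1 \<Longrightarrow> Re (F z) \<ge> 0" and n: "n \<noteq> 0"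
  shows "norm (coeff0 F n) \<le> 2 * Re (F 0)"
proof -
  have *: "norm (coeff0 F n) * r ^ n \<le> 2 * Re (F 0)" if r: "0 < r" "r < 1" for r
  proof -
    define p where "p = circlepath 0 r"
    have np: "norm (p x) = r" for x using r by (simp add: p_def circlepath norm_mult)
    hence p0: "p x \<noteq> 0" for x using r by (metis less_irrefl norm_zero)
    obtain k where k: "n = Suc k" using n not0_implies_Suc by blast
    \<comment> \<open>On the circle conjugation is inversion up to a constant, so the conjugated
      vanishing integral acquires the kernel of the coefficient formula.\<close>
    have cp: "cnj (p x) = of_real (r\<^sup>2) / p x" for x
      using complex_norm_square[of "p x"] np[of x] p0[of x] by (simp add: field_simps)
    have "((\<lambda>x. cnj (F (p x) * p x ^ n)) has_integral cnj 0) {0..1}"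
      using has_integral_linear[OF circle_has_integral(2)[OF F r, of k] bounded_linear_cnj]
      by (simp add: o_def p_def k)
    from has_integral_mult_right[OF this, of "of_real (1 / r ^ (2 * n))"]
    have "((\<lambda>x. cnj (F (p x)) / p x ^ n) has_integral 0) {0..1}"
      by (rule has_integral_eq_rhs[OF has_integral_eq, rotated])
         (use r p0 in \<open>simp_all add: cp power_divide power_mult power2_eq_square power_mult_distrib field_simps\<close>)
    from has_integral_add[OF circle_has_integral(1)[OF F r, of n] this[unfolded p_def]]
    have 1: "((\<lambda>x. of_real (2 * Re (F (p x))) / p x ^ n) has_integral coeff0 F n) {0..1}"
      by (rule has_integral_eq_rhs[OF has_integral_eq, rotated])
         (simp_all add: p_def complex_add_cnj flip: add_divide_distrib)
    have "((\<lambda>x. Re (F (p x) / p x ^ 0)) has_integral Re (coeff0 F 0)) {0..1}"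
      using has_integral_linear[OF circle_has_integral(1)[OF F r, of 0] bounded_linear_Re]
      by (simp add: o_def p_def)
    from has_integral_mult_right[OF this, of "2 / r ^ n"]
    have 2: "((\<lambda>x. 2 * Re (F (p x)) / r ^ n) has_integral 2 * Re (F 0) / r ^ n) {0..1}"
      by (simp add: coeff0_def)
    have "norm (coeff0 F n) \<le> (2 * Re (F 0) / r ^ n) \<bullet> 1"
    proof (rule has_integral_norm_bound_integral_component[OF 1 2])
      fix x
      have "Re (F (p x)) \<ge> 0" using pos np r by simp
      thus "norm (of_real (2 * Re (F (p x))) / p x ^ n) \<le> (2 * Re (F (p x)) / r ^ n) \<bullet> 1"
        by (simp add: norm_divide norm_power np abs_mult)
    qed
    thus ?thesis using r by (simp add: field_simps)
  qed
  \<comment> \<open>Letting \<open>r\<close> tend to 1 removes the factor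
    \<open>r ^ n\<close>.\<close>
  have "((\<lambda>r. norm (coeff0 F n) * r ^ n) \<longlongrightarrow> norm (coeff0 F n) * 1 ^ n) (at_left 1)"
    by (intro tendsto_intros)
  moreover have "\<forall>\<^sub>F r in at_left (1::real). norm (coeff0 F n) * r ^ n \<le> 2 * Re (F 0)"
    by (rule eventually_mono[OF eventually_at_left_real[OF zero_less_one]]) (use * in auto)
  ultimately show ?thesis using tendsto_upperbound by fastforce
qed

lemma has_fps_expansion_disc:
  "F holomorphic_on ball 0 1 \<Longrightarrow> F has_fps_expansion fps_expansion F 0"
  by (rule has_fps_expansion_fps_expansion[of "ball 0 1"]) auto

lemma coeff0_fps: "F has_fps_expansion A \<Longrightarrow> coeff0 F n = fps_nth A n"
  by (simp add: coeff0_def fps_nth_fps_expansion)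

lemma has_fps_expansion_disc_cong:
  fixes F G :: "complex \<Rightarrow> complex"
  assumes "F has_fps_expansion A" "\<And>z. norm z < 1 \<Longrightarrow> G z = F z"
  shows "G has_fps_expansion A"
proof -
  have "eventually (\<lambda>z. G z = F z) (nhds (0::complex))"
    using assms(2) by (intro eventually_nhds_in_open[of "ball 0 1", THEN eventually_mono]) auto
  thus ?thesis using assms(1) has_fps_expansion_cong by blast
qed

text \<open>For \<open>v = W / z\<close> and \<open>a = \<bar>v 0\<bar>\<close> the other coefficients of \<open>v\<close> are at most \<open>2 (1 - a)\<close>, and
  \<open>a + 2 (1 - a) r / (1 - r) \<le> 1\<close> holds exactly up to \<open>r = 1/3\<close>.\<close>

lemma bohr_schwarz:
  assumes W: "W holomorphic_on ball 0 1" and Wn: "\<And>z. norm z < 1 \<Longrightarrow> norm (W z) \<le> norm z"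
    and r: "0 \<le> r" "r \<le> 1/3"
  shows "(\<Sum>n\<le>N. norm (coeff0 W n) * r ^ n) \<le> r"
proof -
  have W0: "W 0 = 0" using Wn[of 0] by simp
  define v where "v = (\<lambda>z. if z = 0 then deriv W 0 else W z / z)"
  have v: "v holomorphic_on ball 0 1"
    by (rule pole_theorem_0[OF W, of 0]) (use W0 in \<open>auto simp: v_def\<close>)
  have Wv: "W z = z * v z" for z using W0 by (simp add: v_def)
  have vn: "norm (v z) \<le> 1" if "norm z < 1" for z
  proof (cases "z = 0")
    case False thus ?thesis using Wn[OF that] by (simp add: Wv norm_mult)
  next
    case True
    have "norm (W z) < 1" if "norm z < 1" for z using Wn[OF that] that by simp
    from Schwarz_Lemma(2)[OF W W0 this, of 0] True show ?thesis by (simp add: v_def)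
  qed
  define V where "V = fps_expansion v 0"
  have V: "v has_fps_expansion V" unfolding V_def by (rule has_fps_expansion_disc[OF v])
  have "W has_fps_expansion fps_X * V"
    by (rule has_fps_expansion_disc_cong[of "\<lambda>z. z * v z"]) (use Wv in \<open>auto intro!: fps_expansion_intros V\<close>)
  hence cW: "coeff0 W n = (if n = 0 then 0 else coeff0 v (n - 1))" for n
    using coeff0_fps[OF V] by (cases n) (simp_all add: coeff0_fps)
  define a where "a = norm (v 0)"
  have a: "0 \<le> a" "a \<le> 1" using vn[of 0] by (auto simp: a_def)
  \<comment> \<open>The rotation that makes \<open>v 0\<close> real and nonnegative. Then
    \<open>1 - u * v z\<close> has nonnegative real part, with value \<open>1 - a\<close> at
    0.\<close>
  obtain u where u: "norm u = 1" "u * v 0 = of_real a"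
  proof (cases "v 0 = 0")
    case True thus ?thesis using that[of 1] by (simp add: a_def)
  next
    case False
    thus ?thesis using that[of "cnj (v 0) / of_real a"] complex_norm_square[of "v 0"]
      by (simp add: a_def norm_divide field_simps power2_eq_square)
  qed
  have coeff: "norm (coeff0 v n) \<le> 2 * (1 - a)" if n: "n \<noteq> 0" for n
  proof -
    define F where "F = (\<lambda>z. 1 - u * v z)"
    have "norm (coeff0 F n) \<le> 2 * Re (F 0)"
    proof (rule coeff0_Re_nonneg[OF _ _ n])
      show "F holomorphic_on ball 0 1" unfolding F_def by (intro holomorphic_intros v)
      fix z :: complex assume "norm z < 1"
      hence "norm (u * v z) \<le> 1" using vn u by (simp add: norm_mult)
      thus "Re (F z) \<ge> 0" using complex_Re_le_cmod[of "u * v z"] by (simp add: F_def)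
    qed
    moreover have "F has_fps_expansion 1 - fps_const u * V"
      unfolding F_def by (intro fps_expansion_intros V)
    hence "coeff0 F n = - u * coeff0 v n" using n coeff0_fps[OF V] by (simp add: coeff0_fps)
    ultimately show ?thesis using u by (simp add: F_def norm_mult)
  qed
  have geo: "(\<Sum>n=1..M. r ^ n) \<le> 1/2" for M
  proof -
    have "(\<Sum>n=1..M. r ^ n) \<le> (\<Sum>n=1..M. (1/3::real) ^ n)" by (intro sum_mono power_mono r)
    also have "\<dots> = (1 - (1/3) ^ M) / 2" by (induction M) (auto simp: diff_divide_distrib)
    also have "\<dots> \<le> 1/2" by simp
    finally show ?thesis .
  qed
  show ?thesis
  proof (cases N)
    case 0 thus ?thesis using r cW by simp
  next
    case (Suc M)
    have "(\<Sum>n\<le>N. norm (coeff0 W n) * r ^ n) = r * (\<Sum>n\<le>M. norm (coeff0 v n) * r ^ n)"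
      unfolding Suc sum.atMost_Suc_shift by (simp add: cW sum_distrib_left mult_ac)
    also have "(\<Sum>n\<le>M. norm (coeff0 v n) * r ^ n) = a + (\<Sum>n=1..M. norm (coeff0 v n) * r ^ n)"
      by (simp add: atMost_atLeast0 sum.atLeast_Suc_atMost a_def coeff0_def)
    finally have eq: "(\<Sum>n\<le>N. norm (coeff0 W n) * r ^ n) = r * (a + (\<Sum>n=1..M. norm (coeff0 v n) * r ^ n))" .
    have "(\<Sum>n=1..M. norm (coeff0 v n) * r ^ n) \<le> (\<Sum>n=1..M. 2 * (1 - a) * r ^ n)"
      by (intro sum_mono mult_right_mono coeff) (use r in auto)
    also have "\<dots> = 2 * (1 - a) * (\<Sum>n=1..M. r ^ n)" by (simp add: sum_distrib_left)
    also have "\<dots> \<le> 2 * (1 - a) * (1/2)" by (intro mult_left_mono geo) (use a in auto)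
    finally have "a + (\<Sum>n=1..M. norm (coeff0 v n) * r ^ n) \<le> 1" by simp
    thus ?thesis unfolding eq using r by (simp add: mult_left_le)
  qed
qed

text \<open>Truncated majorants are submultiplicative: the pairs with \<open>i + j \<le> N\<close>
  form part of the square \<open>{..N} \<times> {..N}\<close>, and all terms are
  nonnegative.\<close>

lemma fps_power_majorant:
  fixes A :: "'a::{real_normed_div_algebra,comm_ring_1} fps"
  assumes r: "0 \<le> r"
  shows "(\<Sum>n\<le>N. norm (fps_nth (A ^ k) n) * r ^ n) \<le> (\<Sum>n\<le>N. norm (fps_nth A n) * r ^ n) ^ k"
proof (induction k)
  case 0
  have "(\<Sum>n\<le>N. norm (fps_nth (1 :: 'a fps) n) * r ^ n) = (\<Sum>n\<in>{0}. norm (fps_nth (1 :: 'a fps) n) * r ^ n)"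
    by (intro sum.mono_neutral_right) auto
  thus ?case by simp
next
  case (Suc k)
  let ?a = "\<lambda>n. norm (fps_nth A n) * r ^ n" and ?b = "\<lambda>n. norm (fps_nth (A ^ k) n) * r ^ n"
  have "(\<Sum>n\<le>N. norm (fps_nth (A ^ Suc k) n) * r ^ n) \<le> (\<Sum>n\<le>N. \<Sum>i\<le>n. ?a i * ?b (n - i))"
  proof (intro sum_mono)
    fix n
    have "norm (fps_nth (A ^ Suc k) n) \<le> (\<Sum>i\<le>n. norm (fps_nth A i) * norm (fps_nth (A ^ k) (n - i)))"
      unfolding power_Suc fps_mult_nth atLeast0AtMost
      by (rule order_trans[OF norm_sum]) (simp add: norm_mult)
    hence "norm (fps_nth (A ^ Suc k) n) * r ^ n \<le> (\<Sum>i\<le>n. norm (fps_nth A i) * norm (fps_nth (A ^ k) (n - i))) * r ^ n"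
      using r by (intro mult_right_mono) auto
    also have "\<dots> = (\<Sum>i\<le>n. ?a i * ?b (n - i))"
      unfolding sum_distrib_right
    proof (rule sum.cong[OF refl])
      fix i assume "i \<in> {..n}"
      hence "r ^ n = r ^ i * r ^ (n - i)" by (simp flip: power_add)
      thus "norm (fps_nth A i) * norm (fps_nth (A ^ k) (n - i)) * r ^ n = ?a i * ?b (n - i)" by simp
    qed
    finally show "norm (fps_nth (A ^ Suc k) n) * r ^ n \<le> (\<Sum>i\<le>n. ?a i * ?b (n - i))" .
  qed
  also have "\<dots> = (\<Sum>(i, j)\<in>{(i, j). i + j \<le> N}. ?a i * ?b j)"
    by (rule sum.triangle_reindex_eq[symmetric])
  also have "\<dots> \<le> (\<Sum>(i, j)\<in>{..N} \<times> {..N}. ?a i * ?b j)"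
    by (intro sum_mono2) (use r in auto)
  also have "\<dots> = (\<Sum>n\<le>N. ?a n) * (\<Sum>n\<le>N. ?b n)"
    by (simp add: sum_product sum.cartesian_product)
  also have "\<dots> \<le> (\<Sum>n\<le>N. ?a n) * (\<Sum>n\<le>N. ?a n) ^ k"
    by (intro mult_left_mono Suc.IH sum_nonneg) (use r in auto)
  finally show ?case by simp
qed

text \<open>The coefficients of the composition combine those of the powers of \<open>W\<close>. The
  truncated majorant of \<open>W\<close> at \<open>r\<close> is at most \<open>r\<close>, so that of
  its \<open>i\<close>-th power is at most \<open>r ^ i\<close>. Working with partial sums keeps
  every rearrangement finite.\<close>

lemma bohr_subordinate:
  assumes F: "F holomorphic_on ball 0 1" and W: "W holomorphic_on ball 0 1"
    and Wn: "\<And>z. norm z < 1 \<Longrightarrow> norm (W z) \<le> norm z"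
    and G: "\<And>z. norm z < 1 \<Longrightarrow> G z = F (W z)" and r: "0 \<le> r" "r \<le> 1/3"
  shows "(\<Sum>n\<le>N. norm (coeff0 G n) * r ^ n) \<le> (\<Sum>n\<le>N. norm (coeff0 F n) * r ^ n)"
proof -
  define A B where "A = fps_expansion F 0" and "B = fps_expansion W 0"
  have A: "F has_fps_expansion A" and B: "W has_fps_expansion B"
    unfolding A_def B_def by (intro has_fps_expansion_disc F W)+
  have "W 0 = 0" using Wn[of 0] by simp
  hence B0: "fps_nth B 0 = 0" using coeff0_fps[OF B, of 0] by (simp add: coeff0_def)
  have "G has_fps_expansion (A oo B)"
    by (rule has_fps_expansion_disc_cong[OF has_fps_expansion_compose[OF A B B0]]) (simp add: G)
  hence "(\<Sum>n\<le>N. norm (coeff0 G n) * r ^ n) = (\<Sum>n\<le>N. norm (\<Sum>i\<le>n. fps_nth A i * fps_nth (B ^ i) n) * r ^ n)"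
    by (simp add: coeff0_fps fps_compose_nth atLeast0AtMost)
  also have "\<dots> \<le> (\<Sum>n\<le>N. \<Sum>i\<le>n. norm (fps_nth A i) * (norm (fps_nth (B ^ i) n) * r ^ n))"
  proof (intro sum_mono)
    fix n
    have "norm (\<Sum>i\<le>n. fps_nth A i * fps_nth (B ^ i) n) \<le> (\<Sum>i\<le>n. norm (fps_nth A i) * norm (fps_nth (B ^ i) n))"
      by (rule order_trans[OF norm_sum]) (simp add: norm_mult)
    hence "norm (\<Sum>i\<le>n. fps_nth A i * fps_nth (B ^ i) n) * r ^ n \<le> (\<Sum>i\<le>n. norm (fps_nth A i) * norm (fps_nth (B ^ i) n)) * r ^ n"
      using r by (intro mult_right_mono) auto
    thus "norm (\<Sum>i\<le>n. fps_nth A i * fps_nth (B ^ i) n) * r ^ n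
        \<le> (\<Sum>i\<le>n. norm (fps_nth A i) * (norm (fps_nth (B ^ i) n) * r ^ n))"
      by (simp add: sum_distrib_left sum_distrib_right mult_ac)
  qed
  \<comment> \<open>Nonnegative terms with \<open>i > n\<close> are added to make the range
    rectangular, so that the sums can be exchanged.\<close>
  also have "\<dots> \<le> (\<Sum>n\<le>N. \<Sum>i\<le>N. norm (fps_nth A i) * (norm (fps_nth (B ^ i) n) * r ^ n))"
    by (intro sum_mono sum_mono2) (use r in auto)
  also have "\<dots> = (\<Sum>i\<le>N. norm (fps_nth A i) * (\<Sum>n\<le>N. norm (fps_nth (B ^ i) n) * r ^ n))"
    by (subst sum.swap) (simp add: sum_distrib_left)
  also have "\<dots> \<le> (\<Sum>i\<le>N. norm (fps_nth A i) * r ^ i)"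
  proof (intro sum_mono mult_left_mono)
    fix i
    have "(\<Sum>n\<le>N. norm (fps_nth (B ^ i) n) * r ^ n) \<le> (\<Sum>n\<le>N. norm (fps_nth B n) * r ^ n) ^ i"
      by (rule fps_power_majorant[OF r(1)])
    also have "\<dots> \<le> r ^ i"
      using bohr_schwarz[OF W Wn r, of N] coeff0_fps[OF B] r
      by (intro power_mono sum_nonneg) auto
    finally show "(\<Sum>n\<le>N. norm (fps_nth (B ^ i) n) * r ^ n) \<le> r ^ i" .
  qed auto
  also have "\<dots> = (\<Sum>n\<le>N. norm (coeff0 F n) * r ^ n)" by (simp add: coeff0_fps[OF A])
  finally show ?thesis .
qed

section \<open>Majorant series as functions of the radius\<close>

lemma majorant_summable:
  assumes F: "F holomorphic_on ball 0 1" and r: "\<bar>r\<bar> < 1"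
  shows "summable (\<lambda>n. norm (coeff0 F n) * r ^ n)"
proof -
  have "fps_conv_radius (fps_expansion F 0) \<ge> ereal 1"
    by (rule conv_radius_fps_expansion) (use F in simp)
  moreover have "ereal (norm (of_real r :: complex)) < ereal 1" using r by simp
  ultimately have "ereal (norm (of_real r :: complex)) < fps_conv_radius (fps_expansion F 0)" by (rule less_le_trans[rotated])
  from norm_summable_fps[OF this]
  have "summable (\<lambda>n. norm (norm (coeff0 F n) * r ^ n))"
    by (simp add: coeff0_fps[OF has_fps_expansion_disc[OF F]] norm_mult norm_power abs_mult power_abs)
  thus ?thesis by (rule summable_norm_cancel)
qed

lemma coeff0_deriv: "coeff0 (deriv F) n = of_nat (Suc n) * coeff0 F (Suc n)"
  by (simp add: coeff0_def funpow_swap1 field_simps del: of_nat_Suc)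

text \<open>Taking absolute values of coefficients commutes with differentiation, which only
  multiplies them by positive integers and shifts them.\<close>

lemma majorant_deriv:
  assumes F: "F holomorphic_on ball 0 1" and t: "\<bar>t\<bar> < 1"
  shows "(majorant F has_real_derivative majorant (deriv F) t) (at t)"
proof -
  have "((\<lambda>x. \<Sum>n. norm (coeff0 F n) * x ^ n) has_real_derivative
      (\<Sum>n. diffs (\<lambda>n. norm (coeff0 F n)) n * t ^ n)) (at t)"
    by (rule termdiffs_strong'[of 1]) (use majorant_summable[OF F] t in auto)
  moreover have "diffs (\<lambda>n. norm (coeff0 F n)) n = norm (coeff0 (deriv F) n)" for n
    by (simp add: diffs_def coeff0_deriv norm_mult del: of_nat_Suc)
  ultimately show ?thesis unfolding majorant_def[abs_def] by simp
qed

lemma majorant_continuous: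
  assumes F: "F holomorphic_on ball 0 1" and S: "S \<subseteq> {-1<..<1}"
  shows "continuous_on S (majorant F)"
  by (rule DERIV_continuous_on[where D = "majorant (deriv F)"])
     (use S in \<open>auto intro!: has_field_derivative_at_within majorant_deriv[OF F] simp: abs_less_iff subset_iff\<close>)

lemma majorant_nonneg:
  assumes F: "F holomorphic_on ball 0 1" and t: "0 \<le> t" "t < 1"
  shows "0 \<le> majorant F t"
  unfolding majorant_def by (rule suminf_nonneg[OF majorant_summable[OF F]]) (use t in auto)

lemma majorant_0: "majorant F 0 = norm (F 0)"
  using powser_zero[of "\<lambda>n. norm (coeff0 F n)"] by (simp add: majorant_def coeff0_def)

lemma majorant_has_integral:
  assumes F: "F holomorphic_on ball 0 1" "F 0 = 0" and r: "0 \<le> r" "r < 1"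
  shows "(majorant (deriv F) has_integral majorant F r) {0..r}"
proof -
  have "(majorant (deriv F) has_integral majorant F r - majorant F 0) {0..r}"
    by (rule fundamental_theorem_of_calculus)
       (use r in \<open>auto intro!: has_field_derivative_at_within majorant_deriv[OF F(1)]
          simp flip: has_real_derivative_iff_has_vector_derivative\<close>)
  thus ?thesis using F by (simp add: majorant_0)
qed

lemma bohr_subordinate_majorant:
  assumes F: "F holomorphic_on ball 0 1" and W: "W holomorphic_on ball 0 1"
    and Wn: "\<And>z. norm z < 1 \<Longrightarrow> norm (W z) \<le> norm z" and Gh: "G holomorphic_on ball 0 1"
    and G: "\<And>z. norm z < 1 \<Longrightarrow> G z = F (W z)" and r: "0 \<le> r" "r \<le> 1/3"
  shows "majorant G r \<le> majorant F r"
proof -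
  have "(\<lambda>N. \<Sum>n\<le>N. norm (coeff0 X n) * r ^ n) \<longlonglongrightarrow> majorant X r" if "X holomorphic_on ball 0 1" for X
    unfolding majorant_def by (rule summable_LIMSEQ'[OF majorant_summable[OF that]]) (use r in auto)
  from this[OF Gh] this[OF F] show ?thesis
    by (rule LIMSEQ_le) (use bohr_subordinate[OF F W Wn G r] in blast)
qed

text \<open>The shape of the relation between the derivatives of \<open>g\<close> and
  \<open>h\<close>; multiplication by \<open>\<alpha> * z\<close> shifts the coefficients and scales
  them.\<close>

lemma majorant_times_z:
  assumes H: "H holomorphic_on ball 0 1" and G: "\<And>z. norm z < 1 \<Longrightarrow> G z = \<alpha> * z * H z"
    and t: "0 \<le> t" "t < 1"
  shows "majorant G t = norm \<alpha> * (t * majorant H t)"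
proof -
  define A where "A = fps_expansion H 0"
  have A: "H has_fps_expansion A" unfolding A_def by (rule has_fps_expansion_disc[OF H])
  have G': "G has_fps_expansion fps_const \<alpha> * fps_X * A"
    by (rule has_fps_expansion_disc_cong[of "\<lambda>z. \<alpha> * z * H z"]) (use G in \<open>auto intro!: fps_expansion_intros A\<close>)
  have s: "summable (\<lambda>n. norm (coeff0 H n) * t ^ n)" by (rule majorant_summable[OF H]) (use t in auto)
  have c: "coeff0 G 0 = 0" "coeff0 G (Suc n) = \<alpha> * coeff0 H n" for n
    using coeff0_fps[OF G'] coeff0_fps[OF A] by (simp_all add: mult.assoc)
  have "(\<lambda>n. norm \<alpha> * t * (norm (coeff0 H n) * t ^ n)) sums (norm \<alpha> * t * majorant H t)"
    unfolding majorant_def by (intro sums_mult summable_sums s)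
  hence "(\<lambda>n. norm (coeff0 G (Suc n)) * t ^ Suc n) sums (norm \<alpha> * t * majorant H t)"
    by (simp add: c norm_mult mult_ac)
  from sums_Suc[OF this] show ?thesis
    unfolding majorant_def by (simp add: c sums_iff mult_ac)
qed

subsection \<open>Harmonic maps with convex analytic part\<close>

text \<open>Otherwise the inverse would be entire and bounded, hence constant by Liouville, yet it
  takes the values 0 and 1/2.\<close>

lemma inj_holomorphic_not_onto:
  assumes h: "h holomorphic_on ball 0 1" "inj_on h (ball 0 1)"
  shows "h ` ball 0 1 \<noteq> UNIV"
proof
  assume onto: "h ` ball 0 1 = UNIV"
  obtain H where H: "H holomorphic_on h ` ball 0 1" "\<And>z. z \<in> ball 0 1 \<Longrightarrow> H (h z) = z"
    using holomorphic_has_inverse[OF h(1) open_ball h(2)] by metis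
  have "range H \<subseteq> ball 0 1"
  proof clarify
    fix x
    have "x \<in> h ` ball 0 1" using onto by simp
    thus "H x \<in> ball 0 1" using H(2) by auto
  qed
  hence "bounded (range H)" using bounded_ball bounded_subset by blast
  then obtain c where "\<And>x. H x = c" using Liouville_theorem[of H] H(1) onto by (auto simp: constant_on_def)
  hence "0 = c" "1/2 = c" using H(2)[of 0] H(2)[of "1/2"] by auto
  thus False by simp
qed

text \<open>\<open>dg\<close> bounds the dilatation by \<open>norm z\<close>, hence away from 1 on
  smaller discs. \<open>conv\<close> is stated for closed discs, so that the mean value inequality
  can be used on their images with that constant.\<close>

locale harmonic_disc =
  fixes h g :: "complex \<Rightarrow> complex"
  assumes h: "h holomorphic_on ball 0 1" "inj_on h (ball 0 1)"
    and g: "g holomorphic_on ball 0 1"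
    and dg: "\<And>z. norm z < 1 \<Longrightarrow> norm (deriv g z) \<le> norm z * norm (deriv h z)"
    and conv: "\<And>r. 0 < r \<Longrightarrow> r < 1 \<Longrightarrow> convex (h ` cball 0 r)"
begin

definition f where "f = (\<lambda>z. h z + cnj (g z))"

text \<open>In the variable \<open>w = h z\<close> the function \<open>g\<close> has derivative
  \<open>g' / h'\<close>, of modulus at most \<open>r\<close>, on a convex set.\<close>

lemma g_lipschitz:
  assumes r: "0 < r" "r < 1" and ab: "norm a \<le> r" "norm b \<le> r"
  shows "norm (g a - g b) \<le> r * norm (h a - h b)"
proof -
  obtain H where H: "H holomorphic_on h ` ball 0 1"
    "\<And>z. z \<in> ball 0 1 \<Longrightarrow> deriv h z * deriv H (h z) = 1" "\<And>z. z \<in> ball 0 1 \<Longrightarrow> H (h z) = z"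
    using holomorphic_has_inverse[OF h(1) open_ball h(2)] by metis
  have op: "open (h ` ball 0 1)" by (rule open_mapping_thm3[OF h(1) open_ball h(2)])
  have "norm ((\<lambda>w. g (H w)) (h a) - (\<lambda>w. g (H w)) (h b)) \<le> r * norm (h a - h b)"
  proof (rule field_differentiable_bound[OF conv[OF r]])
    show "h a \<in> h ` cball 0 r" "h b \<in> h ` cball 0 r" using ab by auto
    fix w assume "w \<in> h ` cball 0 r"
    then obtain z where z: "w = h z" "norm z \<le> r" by auto
    have zb: "z \<in> ball 0 1" using z r by simp
    have dH: "(H has_field_derivative deriv H w) (at w)"
      using H(1) op zb z by (intro holomorphic_derivI) auto
    have dg': "(g has_field_derivative deriv g (H w)) (at (H w))"
      using g zb z H(3) by (intro holomorphic_derivI) auto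
    show "((\<lambda>w. g (H w)) has_field_derivative deriv g (H w) * deriv H w) (at w within h ` cball 0 r)"
      using DERIV_chain2[OF dg' dH] has_field_derivative_at_within by blast
    have "norm (deriv g (H w) * deriv H w) = norm (deriv g z) * norm (deriv H w)"
      using H(3)[OF zb] z by (simp add: norm_mult)
    also have "\<dots> \<le> norm z * norm (deriv h z) * norm (deriv H w)"
      using dg[of z] zb by (intro mult_right_mono) auto
    also have "\<dots> = norm z * norm (deriv h z * deriv H (h z))" by (simp add: norm_mult z)
    also have "\<dots> \<le> r" using H(2)[OF zb] z by simp
    finally show "norm (deriv g (H w) * deriv H w) \<le> r" .
  qed
  thus ?thesis using H(3) ab r by simp
qed

lemma g_lipschitz1:
  assumes "norm a < 1" "norm b < 1"
  shows "norm (g a - g b) \<le> norm (h a - h b)"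
proof (cases "max (norm a) (norm b) > 0")
  case True
  have "norm (g a - g b) \<le> max (norm a) (norm b) * norm (h a - h b)"
    by (rule g_lipschitz) (use True assms in auto)
  also have "\<dots> \<le> norm (h a - h b)" using assms by (intro mult_left_le_one_le) (auto simp: le_max_iff_disj)
  finally show ?thesis .
next
  case False
  hence "a = 0" "b = 0" by (auto simp: max_def split: if_splits)
  thus ?thesis by simp
qed

text \<open>Equal values of \<open>f\<close> make the increments of \<open>h\<close> and
  \<open>g\<close> equal in modulus, while the increment of \<open>g\<close> is at most
  \<open>r < 1\<close> times that of \<open>h\<close>. The 1/2 in \<open>r\<close> only makes it
  positive.\<close>

lemma inj_f: "inj_on f (ball 0 1)"
proof (rule inj_onI)
  fix a b assume ab: "a \<in> ball 0 1" "b \<in> ball 0 1" "f a = f b"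
  define r where "r = max (1/2) (max (norm a) (norm b))"
  have r: "0 < r" "r < 1" "norm a \<le> r" "norm b \<le> r" using ab by (auto simp: r_def)
  have "h a - h b = - cnj (g a - g b)" using ab(3) by (simp add: f_def algebra_simps)
  hence "norm (h a - h b) = norm (g a - g b)" by (metis complex_mod_cnj norm_minus_cancel)
  also have "\<dots> \<le> r * norm (h a - h b)" by (rule g_lipschitz) (use r in auto)
  finally have "(1 - r) * norm (h a - h b) \<le> 0" by (simp add: algebra_simps)
  hence "norm (h a - h b) \<le> 0" using r by (simp add: mult_le_0_iff)
  thus "a = b" using h(2) ab by (auto simp: inj_on_def)
qed

lemma cont: "continuous_on (ball 0 1) h" "continuous_on (ball 0 1) g" "continuous_on (ball 0 1) f"
proof -
  show *: "continuous_on (ball 0 1) h" "continuous_on (ball 0 1) g"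
    using h g by (auto intro: holomorphic_on_imp_continuous_on)
  show "continuous_on (ball 0 1) f" unfolding f_def by (intro continuous_intros *)
qed

lemma open_f: "open (f ` ball 0 1)"
  by (rule invariance_of_domain[OF cont(3) open_ball inj_f])

lemma inverse_f:
  obtains F where "\<And>z. norm z < 1 \<Longrightarrow> F (f z) = z" "continuous_on (f ` ball 0 1) F"
proof -
  have "the_inv_into (ball 0 1) f (f z) = z" if "z \<in> ball 0 1" for z
    by (rule the_inv_into_f_f[OF inj_f that])
  moreover from this have "continuous_on (f ` ball 0 1) (the_inv_into (ball 0 1) f)"
    by (intro continuous_on_inverse_open[OF open_ball cont(3)]) auto
  ultimately show ?thesis using that by auto
qed

text \<open>Since \<open>f\<close> is Lipschitz in the variable \<open>h\<close>, it has a finite limit at a finite boundary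
  point of the image of \<open>h\<close>, and by univalence it omits that limit.\<close>

lemma f_not_onto: "f ` ball 0 1 \<noteq> UNIV"
proof
  assume onto: "f ` ball 0 1 = UNIV"
  obtain F where F: "\<And>z. norm z < 1 \<Longrightarrow> F (f z) = z" "continuous_on UNIV F"
    using inverse_f onto by metis
  have op: "open (h ` ball 0 1)" by (rule open_mapping_thm3[OF h(1) open_ball h(2)])
  have "frontier (h ` ball 0 1) \<noteq> {}"
    using inj_holomorphic_not_onto[OF h] by (auto simp: frontier_eq_empty)
  then obtain p where "p \<in> frontier (h ` ball 0 1)" by blast
  hence p: "p \<in> closure (h ` ball 0 1)" "p \<notin> h ` ball 0 1"
    using op by (auto simp: frontier_def interior_open)
  then obtain w where w: "\<And>n. w n \<in> h ` ball 0 1" "w \<longlonglongrightarrow> p"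
    unfolding closure_sequential by blast
  have "\<forall>n. \<exists>z. norm z < 1 \<and> w n = h z"
    using w(1) by (metis imageE mem_ball_0)
  then obtain z where z: "\<And>n. norm (z n) < 1" "\<And>n. w n = h (z n)" by metis
  have "Cauchy (\<lambda>n. g (z n))"
  proof (rule CauchyI)
    fix e :: real assume "e > 0"
    then obtain M where M: "\<And>m n. m \<ge> M \<Longrightarrow> n \<ge> M \<Longrightarrow> norm (w m - w n) < e"
      using CauchyD[OF LIMSEQ_imp_Cauchy[OF w(2)]] by blast
    show "\<exists>M. \<forall>m\<ge>M. \<forall>n\<ge>M. norm (g (z m) - g (z n)) < e"
    proof (intro exI allI impI)
      fix m n assume "m \<ge> M" "n \<ge> M"
      thus "norm (g (z m) - g (z n)) < e"
        using M[of m n] g_lipschitz1[OF z(1)[of m] z(1)[of n]] z(2) by simp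
    qed
  qed
  then obtain q where "(\<lambda>n. g (z n)) \<longlonglongrightarrow> q" using Cauchy_convergent convergent_def by blast
  moreover have "w = (\<lambda>n. h (z n))" using z(2) by (rule ext)
  hence hz: "(\<lambda>n. h (z n)) \<longlonglongrightarrow> p" using w(2) by (rule subst[where P = "\<lambda>x. x \<longlonglongrightarrow> p"])
  ultimately have "(\<lambda>n. f (z n)) \<longlonglongrightarrow> p + cnj q"
    unfolding f_def by (intro tendsto_intros)
  moreover have "isCont F (p + cnj q)" using F(2) by (simp add: continuous_on_eq_continuous_at)
  ultimately have "(\<lambda>n. F (f (z n))) \<longlonglongrightarrow> F (p + cnj q)"
    using isCont_tendsto_compose[of "p + cnj q" F "\<lambda>n. f (z n)"] by blast
  \<comment> \<open>The preimages would converge to a point inside the disc, where continuity gives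
    \<open>h\<close> the value \<open>p\<close> that it omits.\<close>
  hence zl: "z \<longlonglongrightarrow> F (p + cnj q)" using F(1) z(1) by simp
  have "p + cnj q \<in> f ` ball 0 1" using onto by simp
  hence Fb: "F (p + cnj q) \<in> ball 0 1" using F(1) by auto
  hence "isCont h (F (p + cnj q))"
    using cont(1) by (simp add: continuous_on_eq_continuous_at)
  from isCont_tendsto_compose[OF this zl]
  have "(\<lambda>n. h (z n)) \<longlonglongrightarrow> h (F (p + cnj q))" .
  hence "p = h (F (p + cnj q))" by (rule LIMSEQ_unique[OF hz])
  thus False using p(2) Fb by blast
qed

section \<open>Distance from the origin to the boundary of the harmonic image\<close>

text \<open>The differential of \<open>f\<close> is \<open>a * v + cnj (b * v)\<close> with Jacobian
  \<open>d\<close>, and \<open>D\<close> is its explicit inverse. The norm bound comes from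
  cancelling \<open>norm a + norm b\<close> against \<open>d\<close>.\<close>

lemma f_inverse_derivative:
  assumes x: "norm x < 1" and F: "\<And>z. norm z < 1 \<Longrightarrow> F (f z) = z"
    and lt: "norm (deriv g x) < norm (deriv h x)"
  obtains D where "(F has_derivative D) (at (f x))"
    "\<And>w. norm (D w) \<le> norm w / (norm (deriv h x) - norm (deriv g x))"
proof -
  define a b where "a = deriv h x" and "b = deriv g x"
  define d where "d = (norm a)\<^sup>2 - (norm b)\<^sup>2"
  have ab: "norm b < norm a" using lt by (simp add: a_def b_def)
  hence d: "d > 0" by (simp add: d_def power_strict_mono)
  define D where "D = (\<lambda>w. (cnj a * w - cnj b * cnj w) / of_real d)"
  have dh: "(h has_derivative (\<lambda>v. a * v)) (at x)" and dg': "(g has_derivative (\<lambda>v. b * v)) (at x)"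
    unfolding a_def b_def using h(1) g x
    by (auto intro!: holomorphic_derivI simp flip: has_field_derivative_def)
  have "((\<lambda>z. cnj (g z)) has_derivative (\<lambda>v. cnj (b * v))) (at x)"
    by (rule bounded_linear.has_derivative[OF bounded_linear_cnj dg'])
  hence df: "(f has_derivative (\<lambda>v. a * v + cnj (b * v))) (at x)"
    unfolding f_def by (intro has_derivative_add dh)
  have "(F has_derivative D) (at (f x))"
  proof (rule has_derivative_inverse_strong[OF open_ball _ cont(3) _ df])
    show "x \<in> ball 0 1" "\<And>y. y \<in> ball 0 1 \<Longrightarrow> F (f y) = y" using x F by auto
    show "(\<lambda>v. a * v + cnj (b * v)) \<circ> D = id"
    proof
      fix w
      have "a * D w + cnj (b * D w) = (a * cnj a - b * cnj b) * w / of_real d"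
        by (simp add: D_def algebra_simps flip: add_divide_distrib diff_divide_distrib)
      also have "a * cnj a - b * cnj b = of_real d"
        by (simp add: d_def flip: complex_norm_square)
      finally show "((\<lambda>v. a * v + cnj (b * v)) \<circ> D) w = id w" using d by simp
    qed
  qed
  moreover have "norm (D w) \<le> norm w / (norm a - norm b)" for w
  proof -
    have "norm (cnj a * w - cnj b * cnj w) \<le> (norm a + norm b) * norm w"
      using norm_triangle_ineq4[of "cnj a * w" "cnj b * cnj w"] by (simp add: norm_mult algebra_simps)
    hence "norm (D w) \<le> (norm a + norm b) * norm w / d"
      using d by (simp add: D_def norm_divide divide_right_mono)
    also have "d = (norm a + norm b) * (norm a - norm b)"
      by (simp add: d_def power2_eq_square algebra_simps)
    also have "(norm a + norm b) * norm w / \<dots> = norm w / (norm a - norm b)"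
      using ab by simp (smt (verit) norm_ge_zero)
    finally show ?thesis .
  qed
  ultimately show ?thesis using that by (simp add: a_def b_def)
qed

text \<open>Along the segment the preimage moves with speed at most \<open>1 / m\<close>, evaluated
  at its modulus. As \<open>\<rho>\<close> is a primitive of \<open>m\<close>, the composite of
  \<open>\<rho>\<close> with that modulus has derivative at most 1, so \<open>\<psi>\<close> is
  nondecreasing.\<close>

lemma radial_bound:
  assumes F: "\<And>z. norm z < 1 \<Longrightarrow> F (f z) = z" "continuous_on (f ` ball 0 1) F"
    and f0: "f 0 = 0" and e: "norm e = 1"
    and seg: "\<And>s. 0 \<le> s \<Longrightarrow> s < d \<Longrightarrow> of_real s * e \<in> f ` ball 0 1"
    and \<rho>: "\<And>b. b < 1 \<Longrightarrow> continuous_on {0..b} \<rho>" "\<rho> 0 = 0"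
      "\<And>t. 0 < t \<Longrightarrow> t < 1 \<Longrightarrow> (\<rho> has_real_derivative m t) (at t)"
    and m: "\<And>t. 0 \<le> t \<Longrightarrow> t < 1 \<Longrightarrow> m t > 0"
      "\<And>z. norm z < 1 \<Longrightarrow> norm (deriv h z) - norm (deriv g z) \<ge> m (norm z)"
    and s: "0 \<le> s" "s < d"
  shows "\<rho> (norm (F (of_real s * e))) \<le> s"
proof -
  have img: "norm (F (of_real t * e)) < 1" "f (F (of_real t * e)) = of_real t * e" if "0 \<le> t" "t < d" for t
    using seg[OF that] F(1) by (auto simp del: of_real_mult)
  define \<psi> where "\<psi> = (\<lambda>t. t - \<rho> (norm (F (of_real t * e))))"
  have contz: "continuous_on {0..s} (\<lambda>t. norm (F (of_real t * e)))"
    by (intro continuous_on_norm continuous_on_compose2[OF F(2)] continuous_intros) (use seg s in auto)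
  have ne: "{0..s} \<noteq> {}" using s by simp
  \<comment> \<open>The largest modulus on the segment is below 1, and \<open>\<rho>\<close> is
    continuous up to it.\<close>
  obtain t0 where t0: "t0 \<in> {0..s}" "\<And>t. t \<in> {0..s} \<Longrightarrow> norm (F (of_real t * e)) \<le> norm (F (of_real t0 * e))"
    using continuous_attains_sup[OF compact_Icc ne contz] by blast
  have "continuous_on {0..s} \<psi>"
    unfolding \<psi>_def
    by (intro continuous_intros continuous_on_compose2[OF \<rho>(1)[of "norm (F (of_real t0 * e))"] contz])
       (use t0 img[of t0] s in auto)
  moreover have "\<exists>y. (\<psi> has_real_derivative y) (at t) \<and> y \<ge> 0" if t: "0 < t" "t < s" for t
  proof -
    define x where "x = F (of_real t * e)"
    have x: "norm x < 1" "f x = of_real t * e" using img[of t] t s by (auto simp: x_def)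
    have e0: "e \<noteq> 0" using e by auto
    have x0: "x \<noteq> 0" using x(2) f0 t e0 by auto
    have lt: "norm (deriv g x) < norm (deriv h x)" using m(1)[of "norm x"] m(2)[OF x(1)] x(1) by simp
    obtain D where D: "(F has_derivative D) (at (f x))"
      "\<And>w. norm (D w) \<le> norm w / (norm (deriv h x) - norm (deriv g x))"
      using f_inverse_derivative[OF x(1) F(1) lt] by blast
    interpret D: bounded_linear D using D(1) by (rule has_derivative_bounded_linear)
    have c: "((\<lambda>t. of_real t * e) has_derivative (\<lambda>u. of_real u * e)) (at t)"
      by (auto intro!: derivative_eq_intros)
    have "((\<lambda>t. F (of_real t * e)) has_derivative (\<lambda>u. D (of_real u * e))) (at t)"
      using has_derivative_compose[OF c D(1)[unfolded x(2)]] .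
    hence "((\<lambda>t. norm (F (of_real t * e))) has_derivative (\<lambda>u. inner (D (of_real u * e)) (sgn x))) (at t)"
      using has_derivative_compose has_derivative_norm[OF x0] x_def by blast
    moreover have "(\<lambda>u. inner (D (of_real u * e)) (sgn x)) = (\<lambda>u. inner (D e) (sgn x) * u)"
      by (simp add: D.scaleR fun_eq_iff flip: scaleR_conv_of_real)
    ultimately have dn: "((\<lambda>t. norm (F (of_real t * e))) has_real_derivative inner (D e) (sgn x)) (at t)"
      by (simp add: has_field_derivative_def)
    have "(\<rho> has_real_derivative m (norm x)) (at (norm x))" using \<rho>(3) x x0 by simp
    hence "((\<lambda>t. \<rho> (norm (F (of_real t * e)))) has_real_derivative m (norm x) * inner (D e) (sgn x)) (at t)"
      using DERIV_chain2[OF _ dn] by (simp add: x_def)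
    hence "(\<psi> has_real_derivative 1 - m (norm x) * inner (D e) (sgn x)) (at t)"
      unfolding \<psi>_def by (intro DERIV_diff DERIV_ident)
    moreover have "m (norm x) * inner (D e) (sgn x) \<le> 1"
    proof -
      have mp: "m (norm x) > 0" using m(1) x by simp
      have "inner (D e) (sgn x) \<le> norm (D e) * norm (sgn x)" by (rule norm_cauchy_schwarz)
      also have "\<dots> \<le> 1 / (norm (deriv h x) - norm (deriv g x))"
        using D(2)[of e] e x0 by (simp add: norm_sgn)
      also have "\<dots> \<le> 1 / m (norm x)" using m(2)[OF x(1)] mp by (intro divide_left_mono) auto
      finally show ?thesis using mp by (simp add: field_simps)
    qed
    ultimately show ?thesis by (intro exI[of _ "1 - m (norm x) * inner (D e) (sgn x)"]) auto
  qed
  ultimately have "\<psi> 0 \<le> \<psi> s" by (intro DERIV_nonneg_imp_increasing_open[OF s(1)]) auto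
  moreover have "F 0 = 0" using F(1)[of 0] f0 by simp
  ultimately show ?thesis using \<rho>(2) by (simp add: \<psi>_def)
qed

text \<open>If the nearest frontier point were closer than \<open>\<rho> r\<close>, the radial bound
  would keep the preimage of the segment towards it in \<open>cball 0 r\<close>. The image of that
  disc is closed, so it would contain the frontier point, but the full image is open.\<close>

lemma infdist_frontier_ge:
  assumes f0: "f 0 = 0"
    and \<rho>: "\<And>b. b < 1 \<Longrightarrow> continuous_on {0..b} \<rho>" "\<rho> 0 = 0"
      "\<And>t. 0 < t \<Longrightarrow> t < 1 \<Longrightarrow> (\<rho> has_real_derivative m t) (at t)"
    and m: "\<And>t. 0 \<le> t \<Longrightarrow> t < 1 \<Longrightarrow> m t > 0"
      "\<And>z. norm z < 1 \<Longrightarrow> norm (deriv h z) - norm (deriv g z) \<ge> m (norm z)"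
    and r: "0 < r" "r < 1"
  shows "\<rho> r \<le> infdist 0 (frontier (f ` ball 0 1))"
proof (rule ccontr)
  define S where "S = f ` ball 0 1"
  assume "\<not> ?thesis"
  hence less: "infdist 0 (frontier S) < \<rho> r" by (simp add: S_def)
  have op: "open S" unfolding S_def by (rule open_f)
  have S0: "0 \<in> S" unfolding S_def using f0 by (metis centre_in_ball imageI zero_less_one)
  \<comment> \<open>The distance to an empty set is 0 by convention, so a nearest frontier point has
    to be secured first.\<close>
  have ne: "frontier S \<noteq> {}" using f_not_onto S0 by (auto simp: frontier_eq_empty S_def)
  obtain w0 where w0: "w0 \<in> frontier S" "infdist 0 (frontier S) = dist 0 w0"
    using infdist_attains_inf[OF frontier_closed ne] by blast
  have w0S: "w0 \<notin> S" using w0(1) op by (simp add: frontier_def interior_open)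
  define d e where "d = norm w0" and "e = sgn w0"
  have "w0 \<noteq> 0" using w0S S0 by auto
  hence d: "d > 0" and e: "norm e = 1" and w0e: "w0 = of_real d * e"
    by (simp_all add: d_def e_def norm_sgn) (simp add: sgn_eq)
  have far: "d \<le> norm w" if "w \<in> frontier S" for w
    using infdist_le[OF that, of 0] w0(2) by (simp add: d_def)
  \<comment> \<open>A missing point would yield a frontier point closer than
    \<open>d\<close>.\<close>
  have seg: "of_real s * e \<in> S" if "0 \<le> s" "s < d" for s
  proof (rule ccontr)
    assume "of_real s * e \<notin> S"
    hence "closed_segment 0 (of_real s * e) \<inter> frontier S \<noteq> {}"
      by (intro connected_Int_frontier connected_segment) (use S0 in auto)
    then obtain w where w: "w \<in> closed_segment 0 (of_real s * e)" "w \<in> frontier S" by blast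
    then obtain u where "0 \<le> u" "u \<le> 1" "w = u *\<^sub>R (of_real s * e)" by (auto simp: in_segment)
    hence "norm w \<le> s" using e that by (simp add: norm_mult mult_left_le_one_le)
    thus False using far[OF w(2)] that by simp
  qed
  obtain F where F: "\<And>z. norm z < 1 \<Longrightarrow> F (f z) = z" "continuous_on (f ` ball 0 1) F"
    using inverse_f by blast
  have incr: "\<rho> r < \<rho> b" if "r < b" "b < 1" for b
  proof (rule DERIV_pos_imp_increasing[OF that(1)])
    fix x assume "r \<le> x" "x \<le> b"
    thus "\<exists>y. (\<rho> has_real_derivative y) (at x) \<and> 0 < y"
      using \<rho>(3)[of x] m(1)[of x] r that by (intro exI[of _ "m x"]) auto
  qed
  have sub: "of_real s * e \<in> f ` cball 0 r" if s: "0 \<le> s" "s < d" for s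
  proof -
    have "\<rho> (norm (F (of_real s * e))) \<le> s"
      by (rule radial_bound[OF F f0 e _ \<rho> m s]) (use seg in \<open>auto simp: S_def\<close>)
    also have "\<dots> < \<rho> r" using s less w0(2) by (simp add: d_def)
    finally have "\<not> r < norm (F (of_real s * e)) \<or> \<not> norm (F (of_real s * e)) < 1" using incr by force
    moreover have "norm (F (of_real s * e)) < 1" "f (F (of_real s * e)) = of_real s * e"
      using seg[OF s] F(1) by (auto simp: S_def)
    ultimately show ?thesis by (intro image_eqI[of _ _ "F (of_real s * e)"]) auto
  qed
  have "closed (f ` cball 0 r)"
    using r by (intro compact_imp_closed compact_continuous_image compact_cball
        continuous_on_subset[OF cont(3)]) auto
  moreover have "((\<lambda>s. of_real s * e) \<longlongrightarrow> of_real d * e) (at_left d)" by (intro tendsto_intros)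
  moreover have "\<forall>\<^sub>F s in at_left d. of_real s * e \<in> f ` cball 0 r"
    by (rule eventually_mono[OF eventually_at_left_real[OF d]]) (use sub in auto)
  ultimately have "of_real d * e \<in> f ` cball 0 r"
    by (intro Lim_in_closed_set[of "f ` cball 0 r"]) auto
  hence "w0 \<in> S" using r by (auto simp: w0e S_def)
  thus False using w0S by simp
qed

end

subsection \<open>The class of convex functions of Ma and Minda\<close>

text \<open>The difference of the two sides has derivative 0: away from 0 by the symmetry of
  \<open>q\<close>, at 0 because the derivative of \<open>Q\<close> is real there. It also vanishes
  at 0.\<close>

lemma primitive_reflection:
  assumes Q: "Q holomorphic_on ball 0 1" "cnj (Q 0) = Q 0" "cnj (deriv Q 0) = deriv Q 0"
    and dQ: "\<And>z. norm z < 1 \<Longrightarrow> z * deriv Q z = q z"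
    and q: "\<And>z. norm z < 1 \<Longrightarrow> q (cnj z) = cnj (q z)" and z: "norm z < 1"
  shows "Q (cnj z) = cnj (Q z)"
proof -
  have "\<exists>c. \<forall>z\<in>ball 0 1. Q z - cnj (Q (cnj z)) = c"
  proof (rule has_field_derivative_zero_constant[OF convex_ball])
    fix z :: complex assume z: "z \<in> ball 0 1"
    hence nz: "norm z < 1" "norm (cnj z) < 1" by auto
    have d1: "(Q has_field_derivative deriv Q z) (at z)" if "norm z < 1" for z :: complex
      using Q(1) that by (intro holomorphic_derivI) auto
    have d2: "((\<lambda>z. cnj (Q (cnj z))) has_field_derivative cnj (deriv Q (cnj z))) (at z)"
      using has_field_derivative_cnj_cnj[OF d1[OF nz(2)]] by (simp add: o_def)
    have "deriv Q z = cnj (deriv Q (cnj z))"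
    proof (cases "z = 0")
      case False
      have "z * deriv Q z = z * cnj (deriv Q (cnj z))"
        using dQ[OF nz(1)] arg_cong[OF dQ[OF nz(2)], of cnj] q[OF nz(1)] by simp
      thus ?thesis using False by simp
    qed (use Q in simp)
    thus "((\<lambda>z. Q z - cnj (Q (cnj z))) has_field_derivative 0) (at z within ball 0 1)"
      using DERIV_diff[OF d1[OF nz(1)] d2] has_field_derivative_at_within by force
  qed
  then obtain c where c: "\<And>z. z \<in> ball 0 1 \<Longrightarrow> Q z - cnj (Q (cnj z)) = c" by blast
  have "c = 0" using c[of 0] Q(2) by simp
  thus ?thesis using c[of "cnj z"] z by simp
qed

lemma ma_minda_starlike:
  assumes "ma_minda \<phi>"
  shows "starlike_disc (\<lambda>z. \<phi> z - 1)"
proof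
  show "(\<lambda>z. \<phi> z - 1) holomorphic_on ball 0 1" "inj_on (\<lambda>z. \<phi> z - 1) (ball 0 1)" "\<phi> 0 - 1 = 0"
    using assms by (auto simp: ma_minda_def inj_on_def intro!: holomorphic_intros)
  fix z :: complex and t :: real assume z: "norm z < 1" and t: "0 \<le> t" "t \<le> 1"
  have "1 + of_real t * (\<phi> z - 1) \<in> closed_segment 1 (\<phi> z)"
    unfolding in_segment using t by (intro exI[of _ t]) (auto simp: scaleR_conv_of_real algebra_simps)
  hence "1 + of_real t * (\<phi> z - 1) \<in> \<phi> ` ball 0 1" using assms z unfolding ma_minda_def by force
  then obtain y where "y \<in> ball 0 1" "\<phi> y = 1 + of_real t * (\<phi> z - 1)" by (metis imageE)
  thus "of_real t * (\<phi> z - 1) \<in> (\<lambda>z. \<phi> z - 1) ` ball 0 1" by (intro image_eqI[of _ _ y]) auto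
qed

lemma ma_minda_reflection:
  assumes phi: "ma_minda \<phi>" and z: "norm z < 1"
  shows "\<phi> (cnj z) = cnj (\<phi> z)"
  by (rule univalent_reflection[OF _ _ _ _ _ z])
     (use phi in \<open>auto simp: ma_minda_def Reals_cnj_iff\<close>)

text \<open>For \<open>0 \<le> t < 1\<close> the real number \<open>k t\<close> is the value of
  \<open>deriv K\<close> at \<open>-t\<close>. The lower bound on \<open>deriv h\<close> needs only
  that \<open>W z\<close> stays in the disc of radius \<open>norm z\<close>, where the real part of
  the logarithm of \<open>deriv K\<close> is least at \<open>- norm z\<close>.\<close>

lemma ma_minda_convex:
  assumes phi: "ma_minda \<phi>" and K: "K holomorphic_on ball 0 1" "deriv K 0 = 1"
    and K'_nz: "\<And>z. norm z < 1 \<Longrightarrow> deriv K z \<noteq> 0"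
    and K_ode: "\<And>z. norm z < 1 \<Longrightarrow> 1 + z * deriv (deriv K) z / deriv K z = \<phi> z"
    and h: "convex_class \<phi> h"
  obtains W k where "W holomorphic_on ball 0 1" "\<And>z. norm z < 1 \<Longrightarrow> norm (W z) \<le> norm z"
    "\<And>z. norm z < 1 \<Longrightarrow> deriv h z = deriv K (W z)"
    "\<And>t. 0 \<le> t \<Longrightarrow> t < 1 \<Longrightarrow> deriv K (- of_real t) = of_real (k t)"
    "\<And>t. k t > (0::real)" "\<And>z. norm z < 1 \<Longrightarrow> k (norm z) \<le> norm (deriv h z)"
proof -
  define q where "q = (\<lambda>z. \<phi> z - 1)"
  interpret starlike_disc q unfolding q_def by (rule ma_minda_starlike[OF phi])
  have dq0: "(q has_field_derivative deriv \<phi> 0) (at 0)"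
    unfolding q_def using phi
    by (auto intro!: derivative_eq_intros holomorphic_derivI[of \<phi> "ball 0 1"] simp: ma_minda_def)
  have pos0: "Re (deriv \<phi> 0) > 0" "cnj (deriv \<phi> 0) = deriv \<phi> 0"
    using phi by (auto simp: ma_minda_def Reals_cnj_iff)
  have h': "h holomorphic_on ball 0 1" "inj_on h (ball 0 1)" "deriv h 0 = 1"
    using h by (auto simp: convex_class_def)
  obtain \<omega> where \<omega>: "\<omega> holomorphic_on ball 0 1" "\<omega> ` ball 0 1 \<subseteq> ball 0 1" "\<omega> 0 = 0"
    "\<And>z. norm z < 1 \<Longrightarrow> 1 + z * deriv (deriv h) z / deriv h z = \<phi> (\<omega> z)"
    using h by (auto simp: convex_class_def subordinate_def)
  have "norm (\<omega> z) < 1" if "norm z < 1" for z using \<omega>(2) that by (simp add: image_subset_iff)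
  note \<omega>n = Schwarz_Lemma(1)[OF \<omega>(1,3) this]
  have h_nz: "deriv h z \<noteq> 0" if "norm z < 1" for z
    using holomorphic_injective_imp_regular[OF h'(1) open_ball h'(2)] that by simp
  have dK: "deriv K holomorphic_on ball 0 1" "deriv h holomorphic_on ball 0 1"
    using K h' by (auto intro: holomorphic_deriv)
  obtain Q where Q: "Q holomorphic_on ball 0 1" "Q 0 = 0" "\<And>z. norm z < 1 \<Longrightarrow> deriv K z = exp (Q z)"
    "\<And>z. norm z < 1 \<Longrightarrow> deriv Q z = deriv (deriv K) z / deriv K z"
    using exp_primitive[OF dK(1) K(2) K'_nz] by blast
  obtain P where P: "P holomorphic_on ball 0 1" "P 0 = 0" "\<And>z. norm z < 1 \<Longrightarrow> deriv h z = exp (P z)"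
    "\<And>z. norm z < 1 \<Longrightarrow> deriv P z = deriv (deriv h) z / deriv h z"
    using exp_primitive[OF dK(2) h'(3) h_nz] by blast
  have dQ: "z * deriv Q z = q z" if "norm z < 1" for z
    using K_ode[OF that] Q(4)[OF that] by (simp add: q_def algebra_simps)
  have dP: "z * deriv P z = q (\<omega> z)" if "norm z < 1" for z
    using \<omega>(4)[OF that] P(4)[OF that] by (simp add: q_def algebra_simps)
  \<comment> \<open>The identity \<open>z * deriv Q z = q z\<close> is empty at 0, so the value
    there is recovered by differentiating it.\<close>
  have "((\<lambda>z. z * deriv Q z) has_field_derivative deriv Q 0) (at 0)"
    using Q(1) by (auto intro!: derivative_eq_intros holomorphic_derivI[of _ "ball 0 1"] holomorphic_deriv)
  hence "(q has_field_derivative deriv Q 0) (at 0)"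
    by (rule has_field_derivative_transform_within_open[OF _ open_ball[of 0 1]]) (use dQ in auto)
  hence dQ0: "deriv Q 0 = deriv \<phi> 0" using dq0 DERIV_unique by blast
  hence "deriv Q 0 \<noteq> 0" using pos0 by auto
  note Qprop = primitive_inj_Re[OF Q(1) dQ this]
  obtain W where W: "W holomorphic_on ball 0 1" "W 0 = 0"
    "\<And>z. norm z < 1 \<Longrightarrow> norm (W z) \<le> norm z" "\<And>z. norm z < 1 \<Longrightarrow> Q (W z) = P z"
    using primitive_subordinate[OF P(1,2) Q(1,2) Qprop(1) dQ dP \<omega>n] by blast
  have hK: "deriv h z = deriv K (W z)" if "norm z < 1" for z
    using W(3,4)[OF that] P(3)[OF that] Q(3)[of "W z"] that by simp
  have qr: "q (cnj z) = cnj (q z)" if "norm z < 1" for z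
    using ma_minda_reflection[OF phi that] by (simp add: q_def)
  have Qr: "Q (cnj z) = cnj (Q z)" if "norm z < 1" for z
    by (rule primitive_reflection[OF Q(1) _ _ dQ qr that]) (use Q(2) dQ0 pos0 in auto)
  define k where "k = (\<lambda>t::real. exp (Re (Q (- of_real t))))"
  have kK: "deriv K (- of_real t) = of_real (k t)" if "0 \<le> t" "t < 1" for t
  proof -
    have n: "norm (- of_real t :: complex) < 1" using that by simp
    have "Im (Q (- of_real t)) = 0" using Qr[OF n] by (simp add: complex_eq_iff)
    hence "Q (- of_real t) = of_real (Re (Q (- of_real t)))" by (simp add: complex_eq_iff)
    thus ?thesis using Q(3)[OF n] by (metis exp_of_real k_def)
  qed
  have kh: "k (norm z) \<le> norm (deriv h z)" if z: "norm z < 1" for z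
  proof (cases "z = 0")
    case True thus ?thesis using Q(2) h'(3) by (simp add: k_def)
  next
    case False
    obtain m where m: "m > 0" "q (- of_real (norm z)) = - of_real m"
      using negative_axis[OF holo inj zero _ qr, of "norm z"] dq0[THEN DERIV_imp_deriv] pos0 z False by auto
    \<comment> \<open>On the negative axis the outer normal is a negative real number, so the
      support line is vertical and the image lies to its right.\<close>
    have "Re (cnj (q (- of_real (norm z))) * Q (W z)) \<le> Re (cnj (q (- of_real (norm z))) * Q (- of_real (norm z)))"
      by (rule Qprop(2)) (use z False W(3)[OF z] in auto)
    hence "Re (Q (- of_real (norm z))) \<le> Re (Q (W z))" using m by simp
    thus ?thesis using P(3)[OF z] W(4)[OF z] by (simp add: k_def norm_exp_eq_Re)
  qed
  have k0: "k t > 0" for t by (simp add: k_def)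
  show ?thesis by (rule that[OF W(1,3) hK kK k0 kh])
qed

text \<open>Subordination to \<open>\<phi>\<close> gives \<open>1 + z * h'' / h'\<close> positive
  real part, so the normals of image circles never repeat a direction.\<close>

lemma convex_class_convex:
  assumes phi: "ma_minda \<phi>" and h: "convex_class \<phi> h" and r: "0 < r" "r < 1"
  shows "convex (h ` cball 0 r)"
proof -
  have h': "h holomorphic_on ball 0 1" "inj_on h (ball 0 1)" "deriv h 0 = 1"
    using h by (auto simp: convex_class_def)
  have nz: "deriv h z \<noteq> 0" if "norm z < 1" for z
    using holomorphic_injective_imp_regular[OF h'(1) open_ball h'(2)] that by simp
  obtain \<omega> where \<omega>: "\<omega> ` ball 0 1 \<subseteq> ball 0 1"
    "\<And>z. norm z < 1 \<Longrightarrow> 1 + z * deriv (deriv h) z / deriv h z = \<phi> (\<omega> z)"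
    using h by (auto simp: convex_class_def subordinate_def)
  have "Re (1 + z * deriv (deriv h) z / deriv h z) > 0" if "norm z < 1" for z
  proof -
    have "\<omega> z \<in> ball 0 1" using \<omega>(1) that by (simp add: image_subset_iff)
    thus ?thesis using phi \<omega>(2)[OF that] by (simp add: ma_minda_def)
  qed
  from convex_rays[OF h'(1,3) nz this] show ?thesis
    by (intro circle_support_convex[OF h'(1) nz _ r])
qed

lemma majorant_split:
  assumes F: "F holomorphic_on ball 0 1" "F 0 = 0" and r: "0 \<le> r" "r < 1"
  shows "(\<lambda>n. norm (coeff0 F (n + 2)) * r ^ (n + 2)) sums (majorant F r - norm (deriv F 0) * r)"
proof -
  have "(\<lambda>n. norm (coeff0 F n) * r ^ n) sums majorant F r"
    unfolding majorant_def by (rule summable_sums[OF majorant_summable[OF F(1)]]) (use r in auto)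
  from sums_split_initial_segment[OF this, of 2] show ?thesis
    using F(2) by (simp add: coeff0_def numeral_2_eq_2)
qed

section \<open>The Bohr inequality for the harmonic class\<close>

text \<open>\<open>K\<close> is given on the open disc, so the values at radius 1 in
  \<open>L\<close> enter as the left limits \<open>Km1\<close> and \<open>I1\<close>.
  \<open>K'_nz\<close> keeps the quotient in \<open>K_ode\<close> clear of division by zero.\<close>

theorem theorem2p5:
  fixes \<phi> K h g :: "complex \<Rightarrow> complex"
    and \<alpha> :: complex and Km1 I1 L rf :: real
  assumes phi: "ma_minda \<phi>"
    and K_hol: "K holomorphic_on unit_disc"
    and K0: "K 0 = 0" and K'0: "deriv K 0 = 1"
    and K'_nz: "\<forall>z\<in>unit_disc. deriv K z \<noteq> 0"
    and K_ode: "\<forall>z\<in>unit_disc. 1 + z * deriv (deriv K) z / deriv K z = \<phi> z"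
    and K_m1: "((\<lambda>t. K (- complex_of_real t)) \<longlongrightarrow> complex_of_real Km1) (at_left 1)"
    and I_1: "((\<lambda>t. integral {0..t} (\<lambda>s. complex_of_real s * deriv K (- complex_of_real s)))
                 \<longlongrightarrow> complex_of_real I1) (at_left 1)"
    and L_def: "L = - Km1 - norm \<alpha> * I1"
    and alpha: "norm \<alpha> \<le> 1"
    and h: "convex_class \<phi> h"
    and g_hol: "g holomorphic_on unit_disc" and g0: "g 0 = 0"
    and g': "\<forall>z\<in>unit_disc. deriv g z = \<alpha> * z * deriv h z"
    and rf_pos: "0 < rf" and rf_lt1: "rf < 1"
    and rf_root: "majorant K rf + norm \<alpha> * integral {0..rf} (\<lambda>t. t * majorant (deriv K) t) = L"
    and rf_least: "\<forall>r. 0 < r \<and> r < rf \<longrightarrow>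
                     majorant K r + norm \<alpha> * integral {0..r} (\<lambda>t. t * majorant (deriv K) t) \<noteq> L"
  shows "\<forall>z::complex. norm z \<le> min (1/3) rf \<longrightarrow>
           norm z + (\<Sum>n. (norm (coeff0 h (n+2)) + norm (coeff0 g (n+2))) * norm z ^ (n+2))
             \<le> infdist ((\<lambda>w. h w + cnj (g w)) 0)
                  (frontier ((\<lambda>w. h w + cnj (g w)) ` unit_disc))"
proof (intro allI impI)
  fix z :: complex assume z: "norm z \<le> min (1/3) rf"
  define r where "r = norm z"
  have r: "0 \<le> r" "r \<le> 1/3" "r < 1" "r \<le> rf" using z by (auto simp: r_def)
  have h': "h holomorphic_on ball 0 1" "inj_on h (ball 0 1)" "h 0 = 0" "deriv h 0 = 1"
    using h by (auto simp: convex_class_def)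
  have K'_nz': "deriv K z \<noteq> 0" and K_ode': "1 + z * deriv (deriv K) z / deriv K z = \<phi> z"
    if "norm z < 1" for z using K'_nz K_ode that by auto
  obtain W k where W: "W holomorphic_on ball 0 1" "\<And>z. norm z < 1 \<Longrightarrow> norm (W z) \<le> norm z"
    and hK: "\<And>z. norm z < 1 \<Longrightarrow> deriv h z = deriv K (W z)"
    and kK: "\<And>t. 0 \<le> t \<Longrightarrow> t < 1 \<Longrightarrow> deriv K (- of_real t) = of_real (k t)"
    and k0: "\<And>t. k t > (0::real)" and kh: "\<And>z. norm z < 1 \<Longrightarrow> k (norm z) \<le> norm (deriv h z)"
    using ma_minda_convex[OF phi K_hol K'0 K'_nz' K_ode' h] by blast
  have dhol: "deriv K holomorphic_on ball 0 1" "deriv h holomorphic_on ball 0 1"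
    using K_hol h' by (auto intro: holomorphic_deriv)
  have norm_dg: "norm (deriv g z) = norm \<alpha> * norm z * norm (deriv h z)" if "norm z < 1" for z
    using g' that by (simp add: norm_mult)

  \<comment> \<open>Bohr's theorem for \<open>deriv h\<close>, which is subordinate to
    \<open>deriv K\<close>; integration transfers the comparison to \<open>h\<close> and
    \<open>g\<close>.\<close>
  have maj: "majorant (deriv h) t \<le> majorant (deriv K) t" if "0 \<le> t" "t \<le> r" for t
    by (rule bohr_subordinate_majorant[OF dhol(1) W dhol(2) hK]) (use that r in auto)
  have Mh: "majorant h r \<le> majorant K r"
    by (rule has_integral_le[OF majorant_has_integral[OF h'(1,3)] majorant_has_integral[OF K_hol K0]])
       (use r maj in auto)
  have cont: "continuous_on {0..s} (\<lambda>t. t * majorant (deriv K) t)" if "s < 1" for s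
    by (intro continuous_intros majorant_continuous[OF dhol(1)]) (use that in auto)
  have nn: "0 \<le> majorant (deriv K) t" if "0 \<le> t" "t < 1" for t by (rule majorant_nonneg[OF dhol(1) that])
  have "majorant g r \<le> norm \<alpha> * integral {0..r} (\<lambda>t. t * majorant (deriv K) t)"
  proof (rule has_integral_le[OF majorant_has_integral[OF g_hol g0 r(1,3)]])
    show "((\<lambda>t. norm \<alpha> * (t * majorant (deriv K) t)) has_integral
        norm \<alpha> * integral {0..r} (\<lambda>t. t * majorant (deriv K) t)) {0..r}"
      by (intro has_integral_mult_right integrable_integral integrable_continuous_real cont r)
    fix t assume t: "t \<in> {0..r}"
    have "majorant (deriv g) t = norm \<alpha> * (t * majorant (deriv h) t)"
      by (rule majorant_times_z[OF dhol(2)]) (use g' t r in auto)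
    also have "\<dots> \<le> norm \<alpha> * (t * majorant (deriv K) t)"
      by (intro mult_left_mono maj) (use t in auto)
    finally show "majorant (deriv g) t \<le> norm \<alpha> * (t * majorant (deriv K) t)" .
  qed
  \<comment> \<open>Both summands grow with the radius, which permits passing from \<open>r\<close>
    to the root \<open>rf\<close>.\<close>
  also have "\<dots> \<le> norm \<alpha> * integral {0..rf} (\<lambda>t. t * majorant (deriv K) t)"
    by (intro mult_left_mono integral_subset_le integrable_continuous_real cont)
       (use r rf_lt1 nn in auto)
  finally have Mg: "majorant g r \<le> norm \<alpha> * integral {0..rf} (\<lambda>t. t * majorant (deriv K) t)" .
  have "majorant K r \<le> majorant K rf"
    by (rule has_integral_subset_le[OF _ majorant_has_integral[OF K_hol K0] majorant_has_integral[OF K_hol K0]])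
       (use r rf_lt1 nn in auto)
  hence upper: "majorant h r + majorant g r \<le> L" using Mh Mg rf_root by linarith
  have "(\<lambda>n. (norm (coeff0 h (n+2)) + norm (coeff0 g (n+2))) * r ^ (n+2)) sums
      (majorant h r - norm (deriv h 0) * r + (majorant g r - norm (deriv g 0) * r))"
    using sums_add[OF majorant_split[OF h'(1,3) r(1,3)] majorant_split[OF g_hol g0 r(1,3)]]
    by (simp add: distrib_right)
  \<comment> \<open>The leading \<open>r\<close> is the linear term of \<open>h\<close>;
    \<open>g\<close> has no linear term since its derivative vanishes at 0. The tails from index 2
    therefore complete both majorants.\<close>
  hence lhs: "r + (\<Sum>n. (norm (coeff0 h (n+2)) + norm (coeff0 g (n+2))) * r ^ (n+2)) = majorant h r + majorant g r"
    using h'(4) norm_dg[of 0] by (simp add: sums_iff)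

  interpret harmonic_disc h g
  proof (rule harmonic_disc.intro[OF h'(1,2) g_hol])
    show "convex (h ` cball 0 r)" if "0 < r" "r < 1" for r
      by (rule convex_class_convex[OF phi h that])
    show "norm (deriv g z) \<le> norm z * norm (deriv h z)" if "norm z < 1" for z
      unfolding norm_dg[OF that] by (intro mult_right_mono mult_left_le_one_le) (use alpha in auto)
  qed
  have f: "(\<lambda>w. h w + cnj (g w)) = f" by (simp add: f_def)
  have f0: "f 0 = 0" using h' g0 by (simp add: f_def)
  \<comment> \<open>A lower bound for the stretching \<open>norm h' - norm g'\<close>, obtained from
    \<open>norm g' = norm \<alpha> * norm z * norm h'\<close> and \<open>kh\<close>.\<close>
  define m where "m = (\<lambda>t. (1 - norm \<alpha> * t) * k t)"
  let ?\<kappa> = "\<lambda>s. complex_of_real s * deriv K (- complex_of_real s)"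
  \<comment> \<open>The primitive of \<open>m\<close> vanishing at 0, written so that its left limit
    at 1 is visibly \<open>L\<close>.\<close>
  define \<rho> where "\<rho> = (\<lambda>t. - Re (K (- complex_of_real t)) - norm \<alpha> * Re (integral {0..t} ?\<kappa>))"
  have at1: "norm \<alpha> * t < 1" if "0 \<le> t" "t < 1" for t
    using mult_right_mono[OF alpha that(1)] that by simp
  have m0: "m t > 0" if "0 \<le> t" "t < 1" for t using at1[OF that] k0 by (simp add: m_def)
  have mh: "norm (deriv h z) - norm (deriv g z) \<ge> m (norm z)" if "norm z < 1" for z
  proof -
    have "m (norm z) \<le> (1 - norm \<alpha> * norm z) * norm (deriv h z)"
      unfolding m_def using at1[of "norm z"] that kh by (intro mult_left_mono) auto
    thus ?thesis by (simp add: norm_dg[OF that] algebra_simps)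
  qed
  have cont\<kappa>: "continuous_on {0..b} ?\<kappa>" if "b < 1" for b
    using that by (intro continuous_intros
        continuous_on_compose2[OF holomorphic_on_imp_continuous_on[OF dhol(1)]]) auto
  have "\<rho> b \<le> infdist 0 (frontier (f ` ball 0 1))" if b: "0 < b" "b < 1" for b
  proof (rule infdist_frontier_ge[OF f0 _ _ _ m0 mh b])
    show "continuous_on {0..b} \<rho>" if "b < 1" for b
    proof -
      have "continuous_on {0..b} (\<lambda>t. K (- complex_of_real t))"
        by (intro continuous_on_compose2[OF holomorphic_on_imp_continuous_on[OF K_hol]] continuous_intros)
           (use that in auto)
      moreover have "continuous_on {0..b} (\<lambda>t. integral {0..t} ?\<kappa>)"
        by (intro indefinite_integral_continuous_1 integrable_continuous_real cont\<kappa> that)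
      ultimately show ?thesis unfolding \<rho>_def by (intro continuous_intros)
    qed
    show "\<rho> 0 = 0" by (simp add: \<rho>_def K0)
    fix t :: real assume t: "0 < t" "t < 1"
    have "((\<lambda>t. Re (K (- complex_of_real t))) has_real_derivative Re (- 1 * deriv K (- complex_of_real t))) (at t)"
      by (rule has_real_derivative_Re_along[OF K_hol open_ball])
         (use t in \<open>auto intro!: derivative_eq_intros simp: has_vector_derivative_def scaleR_conv_of_real\<close>)
    hence 1: "((\<lambda>t. Re (K (- complex_of_real t))) has_real_derivative - k t) (at t)"
      using kK t by simp
    \<comment> \<open>A bound between \<open>t\<close> and 1 makes \<open>t\<close> an interior
      point of the interval, so the derivative within it is a full derivative.\<close>
    define b where "b = (1 + t) / 2"
    have b: "t < b" "b < 1" using t by (auto simp: b_def)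
    have "((\<lambda>u. integral {0..u} ?\<kappa>) has_vector_derivative ?\<kappa> t) (at t within {0..b})"
      by (rule integral_has_vector_derivative[OF cont\<kappa>[OF b(2)]]) (use t b in auto)
    moreover have "at t within {0..b} = at t" using t b by (intro at_within_interior) auto
    ultimately have "((\<lambda>u. integral {0..u} ?\<kappa>) has_vector_derivative ?\<kappa> t) (at t)" by simp
    from bounded_linear.has_vector_derivative[OF bounded_linear_Re this]
    have 2: "((\<lambda>u. Re (integral {0..u} ?\<kappa>)) has_real_derivative t * k t) (at t)"
      using kK t by (simp add: has_real_derivative_iff_has_vector_derivative)
    have "(\<rho> has_real_derivative - (- k t) - norm \<alpha> * (t * k t)) (at t)"
      unfolding \<rho>_def by (intro DERIV_diff DERIV_minus DERIV_cmult 1 2)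
    thus "(\<rho> has_real_derivative m t) (at t)" by (simp add: m_def algebra_simps)
  qed
  moreover have "(\<rho> \<longlongrightarrow> - Re (complex_of_real Km1) - norm \<alpha> * Re (complex_of_real I1)) (at_left 1)"
    unfolding \<rho>_def by (intro tendsto_intros K_m1 I_1)
  \<comment> \<open>The bound holds for every radius below 1 and passes to the limit.\<close>
  ultimately have "L \<le> infdist 0 (frontier (f ` ball 0 1))"
    by (intro tendsto_upperbound[of \<rho> L "at_left 1"]
        eventually_mono[OF eventually_at_left_real[OF zero_less_one]]) (auto simp: L_def)
  thus "norm z + (\<Sum>n. (norm (coeff0 h (n+2)) + norm (coeff0 g (n+2))) * norm z ^ (n+2))
             \<le> infdist ((\<lambda>w. h w + cnj (g w)) 0)
                  (frontier ((\<lambda>w. h w + cnj (g w)) ` unit_disc))"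
    unfolding f using upper lhs h'(3) g0 by (simp add: r_def)
qed

end
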